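(* Assume that $u_0\in H^2(\Omega)\cap H^1_0(\Omega)$ and $f\in L^\infty(0,T;L^2(\Omega))$, and that there is a constant $m_0>0$ with $M(s)\ge m_0$ for all $s\in(0,\infty)$ and $m_0-4L_MK^2>0$, where $K:=\|u_0\|_1+\|f\|_{L^\infty(0,T;L^2(\Omega))}$. Then the numerical solutions $u_h^n$ ($1\le n\le N$) of the fully discrete scheme satisfy, with a constant $C>0$ independent of $h$ and $N$, $$\max_{1\le n\le N}|||u_h^n|||\le C\left(\|\nabla u_0\|+\max_{1\le n\le N}\|f^n\|\right),$$ where $|||u_h^n|||:=\|u_h^n\|+\tau_n^{\alpha/2}\|\nabla u_h^n\|$ for $1\le n\le N$.
   Context: Let $\Omega\subset\mathbb{R}^d$ ($d\ge1$) be a bounded convex domain with smooth boundary, $T>0$, $\alpha\in(0,1)$. $(\cdot,\cdot)$ and $\|\cdot\|$ are the inner product and norm of $L^2(\Omega)$; $\|\cdot\|_m$ is the norm of $H^m(\Omega)$. Data: $M:(0,\infty)\to\mathbb{R}$ is Lipschitz continuous with Lipschitz constant $L_M$ (its value at $0$ is its limit there); $u_0$ and $f$ are given; $b_2(x,t,s)\in\mathbb{R}^{d\times d}$ (symmetric positive definite), $b_1(x,t,s)\in\mathbb{R}^d$, $b_0(x,t,s)\in\mathbb{R}$ are smooth on $\bar\Omega\times[0,T]\times[0,T]$. For $w,v\in H^1_0(\Omega)$ put $B(t,s,w,v)=(b_2(\cdot,t,s)\nabla w,\nabla v)-(b_1(\cdot,t,s)w,\nabla v)+(b_0(\cdot,t,s)w,v)$.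 Space discretization: $X_h\subset H^1_0(\Omega)$ is the space of continuous piecewise linear functions on a shape-regular quasi-uniform triangulation of $\Omega$ with mesh size $h$. $R_hu_0\in X_h$ is the Ritz projection, $(\nabla R_hu_0,\nabla v_h)=(\nabla u_0,\nabla v_h)$ for all $v_h\in X_h$; $f_h^n\in X_h$ is the $L^2$-projection of $f^n=f(\cdot,t_n)$. Time discretization: $t_n=T(n/N)^\delta$, $0\le n\le N$, $\delta\ge1$, $\tau_n=t_n-t_{n-1}$. Put $k_{n,j}=\frac{\tau_j^{-1}}{\Gamma(1-\alpha)}\int_{t_{j-1}}^{t_j}(t_n-s)^{-\alpha}ds$ for $1\le j\le n$ and $\mathbb{D}^\alpha_tw^n=\sum_{j=1}^nk_{n,j}(w^j-w^{j-1})$. Fully discrete scheme: $u_h^0=R_hu_0$, and $u_h^n\in X_h$ ($1\le n\le N$) satisfy, for all $v_h\in X_h$, $(\mathbb{D}^\alpha_tu_h^1,v_h)+M(\|\nabla u_h^1\|^2)(\nabla u_h^1,\nabla v_h)=(f_h^1,v_h)+\tau_1B(t_1,t_1,u_h^1,v_h)$ for $n=1$, and $(\mathbb{D}^\alpha_tu_h^n,v_h)+M(\|\nabla\tilde u_h^{n-1}\|^2)(\nabla u_h^n,\nabla v_h)=(f_h^n,v_h)+\sum_{j=1}^{n-1}\tau_{j+1}\bar B(t_n,t_j,u_h^j,v_h)$ for $n\ge2$, where $\tilde u_h^{n-1}=\big(1+\frac{\tau_n}{\tau_{n-1}}\big)u_h^{n-1}-\frac{\tau_n}{\tau_{n-1}}u_h^{n-2}$,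 $\bar B(t_n,t_j,u_h^j,v_h)=\frac12\big[B(t_n,t_j,u_h^j,v_h)+B(t_n,t_{j+1},u_h^{j+1},v_h)\big]$ for $1\le j\le n-2$, and $\bar B(t_n,t_{n-1},u_h^{n-1},v_h)=B(t_n,t_{n-1},u_h^{n-1},v_h)$ for $j=n-1$. The constant $C$ may depend on the given data ($\Omega,T,\alpha,M,b_0,b_1,b_2,u_0,f$), on $\delta$ and on the shape-regularity of the meshes, but not on the discretization parameters.
   Formalization: The estimate is proved for all N ≥ N_0, with N_0 independent of h and the mesh; for small N it can fail, since the implicit term τ_1 B(t_1,t_1,u_h^1,v_h) may cancel the diffusion (e.g. N=1, u_0=f=0, b_2 slightly larger than a constant M). *)

theory Defs
  imports "HOL-Analysis.Analysis" "HOL-Probability.Essential_Supremum"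
begin

section \<open>Smooth functions and smooth domains\<close>

text \<open>All sets \<open>S\<close> to which \<open>Ck_on\<close> is applied below are open, so that
  \<open>f differentiable_on S\<close> is differentiability at each point of \<open>S\<close>.\<close>

primrec Ck_on :: "nat \<Rightarrow> ('a::euclidean_space \<Rightarrow> real) \<Rightarrow> 'a set \<Rightarrow> bool" where
  "Ck_on 0 f S \<longleftrightarrow> continuous_on S f"
| "Ck_on (Suc k) f S \<longleftrightarrow>
     f differentiable_on S \<and> (\<forall>b\<in>Basis. Ck_on k (\<lambda>x. frechet_derivative f (at x) b) S)"

definition smooth_on :: "'a::euclidean_space set \<Rightarrow> ('a \<Rightarrow> real) \<Rightarrow> bool" where
  "smooth_on S f \<longleftrightarrow> (\<forall>k. Ck_on k f S)"

definition smooth_on_closed :: "'a::euclidean_space set \<Rightarrow> ('a \<Rightarrow> real) \<Rightarrow> bool" where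
  "smooth_on_closed S f \<longleftrightarrow>
     (\<exists>U g. open U \<and> S \<subseteq> U \<and> smooth_on U g \<and> (\<forall>x\<in>S. g x = f x))"

definition smooth_boundary :: "'a::euclidean_space set \<Rightarrow> bool" where
  "smooth_boundary \<Omega> \<longleftrightarrow>
     (\<forall>p\<in>frontier \<Omega>. \<exists>U \<rho>. open U \<and> p \<in> U \<and> smooth_on U \<rho> \<and>
        (\<exists>b\<in>Basis. frechet_derivative \<rho> (at p) b \<noteq> 0) \<and>
        \<Omega> \<inter> U = {x\<in>U. \<rho> x < 0})"

section \<open>Lebesgue and Sobolev spaces on an open set\<close>

text \<open>Elements of function spaces are represented by total functions on \<open>\<real>\<^sup>d\<close>; only their
  values on \<open>\<Omega>\<close>, up to null sets, matter for the notions of this section.\<close>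

definition L2_space :: "(real^'d) set \<Rightarrow> (real^'d \<Rightarrow> real) set" where
  "L2_space \<Omega> = {u. u \<in> borel_measurable (lebesgue_on \<Omega>) \<and>
                     integrable (lebesgue_on \<Omega>) (\<lambda>x. (u x)\<^sup>2)}"

definition L2_inner :: "(real^'d) set \<Rightarrow> (real^'d \<Rightarrow> 'b::real_inner) \<Rightarrow> (real^'d \<Rightarrow> 'b) \<Rightarrow> real" where
  "L2_inner \<Omega> u v = (LINT x|lebesgue_on \<Omega>. u x \<bullet> v x)"

definition L2_norm :: "(real^'d) set \<Rightarrow> (real^'d \<Rightarrow> 'b::real_inner) \<Rightarrow> real" where
  "L2_norm \<Omega> u = sqrt (L2_inner \<Omega> u u)"

definition grad :: "(real^'d \<Rightarrow> real) \<Rightarrow> real^'d \<Rightarrow> real^'d" where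
  "grad \<phi> x = (\<chi> i. frechet_derivative \<phi> (at x) (axis i 1))"

definition test_function :: "(real^'d) set \<Rightarrow> (real^'d \<Rightarrow> real) \<Rightarrow> bool" where
  "test_function \<Omega> \<phi> \<longleftrightarrow> smooth_on UNIV \<phi> \<and>
     compact (closure {x. \<phi> x \<noteq> 0}) \<and> closure {x. \<phi> x \<noteq> 0} \<subseteq> \<Omega>"

definition has_weak_pderiv ::
  "(real^'d) set \<Rightarrow> 'd \<Rightarrow> (real^'d \<Rightarrow> real) \<Rightarrow> (real^'d \<Rightarrow> real) \<Rightarrow> bool" where
  "has_weak_pderiv \<Omega> i u g \<longleftrightarrow> u \<in> L2_space \<Omega> \<and> g \<in> L2_space \<Omega> \<and>
     (\<forall>\<phi>. test_function \<Omega> \<phi> \<longrightarrow>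
        L2_inner \<Omega> u (\<lambda>x. grad \<phi> x $ i) = - L2_inner \<Omega> g \<phi>)"

text \<open>The space \<open>H\<^sup>m(\<Omega>)\<close>.\<close>

primrec sobolev :: "nat \<Rightarrow> (real^'d) set \<Rightarrow> (real^'d \<Rightarrow> real) set" where
  "sobolev 0 \<Omega> = L2_space \<Omega>"
| "sobolev (Suc m) \<Omega> =
     {u \<in> L2_space \<Omega>. \<forall>i. \<exists>g\<in>sobolev m \<Omega>. has_weak_pderiv \<Omega> i u g}"

text \<open>The weak gradient of \<open>u \<in> H\<^sup>1(\<Omega>)\<close>. Weak derivatives are unique up to null sets, so
  it does not matter which representative is chosen.\<close>

definition wgrad :: "(real^'d) set \<Rightarrow> (real^'d \<Rightarrow> real) \<Rightarrow> real^'d \<Rightarrow> real^'d" where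
  "wgrad \<Omega> u x = (\<chi> i. (SOME g. has_weak_pderiv \<Omega> i u g) x)"

definition H1_norm :: "(real^'d) set \<Rightarrow> (real^'d \<Rightarrow> real) \<Rightarrow> real" where
  "H1_norm \<Omega> u = sqrt ((L2_norm \<Omega> u)\<^sup>2 + (L2_norm \<Omega> (wgrad \<Omega> u))\<^sup>2)"

text \<open>\<open>H\<^sup>1\<^sub>0(\<Omega>)\<close> is the closure of the test functions in \<open>H\<^sup>1(\<Omega>)\<close>.\<close>

definition H10_space :: "(real^'d) set \<Rightarrow> (real^'d \<Rightarrow> real) set" where
  "H10_space \<Omega> = {u \<in> sobolev 1 \<Omega>. \<exists>\<phi>. (\<forall>k. test_function \<Omega> (\<phi> k)) \<and>
     (\<lambda>k. L2_norm \<Omega> (\<lambda>x. u x - \<phi> k x)) \<longlonglongrightarrow> 0 \<and>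
     (\<lambda>k. L2_norm \<Omega> (\<lambda>x. wgrad \<Omega> u x - grad (\<phi> k) x)) \<longlonglongrightarrow> 0}"

text \<open>Elements of \<open>L\<^sup>\<infinity>(0,T;L\<^sup>2(\<Omega>))\<close>: strongly measurable, essentially bounded
  \<open>L\<^sup>2(\<Omega>)\<close>-valued functions of time. Since the scheme uses the values \<open>f(\<cdot>,t\<^sub>n)\<close> for
  \<open>0 < t\<^sub>n \<le> T\<close>, \<open>f\<close> is a function defined at every such time, not only almost everywhere.\<close>

definition simple_L2 :: "(real^'d) set \<Rightarrow> (real \<Rightarrow> real^'d \<Rightarrow> real) \<Rightarrow> bool" where
  "simple_L2 \<Omega> s \<longleftrightarrow> (\<exists>m A g. (\<forall>i<m. A i \<in> sets lebesgue \<and> g i \<in> L2_space \<Omega>) \<and>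
     s = (\<lambda>t x. \<Sum>i<(m::nat). indicator (A i) t * g i x))"

definition Linf_L2_norm :: "(real^'d) set \<Rightarrow> real \<Rightarrow> (real \<Rightarrow> real^'d \<Rightarrow> real) \<Rightarrow> ereal" where
  "Linf_L2_norm \<Omega> T f = esssup (lebesgue_on {0<..<T}) (\<lambda>t. ereal (L2_norm \<Omega> (f t)))"

definition Linf_L2_space :: "(real^'d) set \<Rightarrow> real \<Rightarrow> (real \<Rightarrow> real^'d \<Rightarrow> real) set" where
  "Linf_L2_space \<Omega> T = {f. (\<forall>t\<in>{0<..T}. f t \<in> L2_space \<Omega>) \<and>
     (\<exists>s. (\<forall>k. simple_L2 \<Omega> (s k)) \<and>
        (AE t in lebesgue_on {0<..<T}. (\<lambda>k. L2_norm \<Omega> (\<lambda>x. s k t x - f t x)) \<longlonglongrightarrow> 0)) \<and>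
     Linf_L2_norm \<Omega> T f < \<infinity>}"

section \<open>Finite element spaces\<close>

definition mesh_size :: "'a::euclidean_space set set \<Rightarrow> real" where
  "mesh_size \<T> = Max (diameter ` \<T>)"

definition inball_diameter :: "'a::euclidean_space set \<Rightarrow> real" where
  "inball_diameter K = Sup {2 * r |r. 0 \<le> r \<and> (\<exists>x. cball x r \<subseteq> K)}"

text \<open>A domain with curved boundary is not a union of simplices. As usual for convex domains,
  the simplices cover a closed polyhedron inside the closure of \<open>\<Omega>\<close> whose boundary vertices
  lie on the boundary of \<open>\<Omega>\<close> and which exhausts \<open>\<Omega>\<close> up to the mesh size. For \<open>d = 1\<close> these
  conditions say that the simplices subdivide the closed interval exactly.\<close>

definition triangulation_of :: "'a::euclidean_space set \<Rightarrow> 'a set set \<Rightarrow> bool" where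
  "triangulation_of \<Omega> \<T> \<longleftrightarrow>
     triangulation \<T> \<and> \<T> \<noteq> {} \<and> (\<forall>K\<in>\<T>. int DIM('a) simplex K) \<and>
     \<Union>\<T> \<subseteq> closure \<Omega> \<and>
     (\<forall>K\<in>\<T>. \<forall>v. v extreme_point_of K \<and> v \<in> frontier (\<Union>\<T>) \<longrightarrow> v \<in> frontier \<Omega>) \<and>
     (\<forall>x\<in>\<Omega>. infdist x (\<Union>\<T>) \<le> mesh_size \<T>)"

definition shape_regular :: "real \<Rightarrow> 'a::euclidean_space set set \<Rightarrow> bool" where
  "shape_regular \<sigma> \<T> \<longleftrightarrow> (\<forall>K\<in>\<T>. diameter K \<le> \<sigma> * inball_diameter K)"

definition quasi_uniform :: "real \<Rightarrow> 'a::euclidean_space set set \<Rightarrow> bool" where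
  "quasi_uniform \<kappa> \<T> \<longleftrightarrow> (\<forall>K\<in>\<T>. mesh_size \<T> \<le> \<kappa> * diameter K)"

text \<open>The homogeneous boundary condition is encoded in membership in \<open>H\<^sup>1\<^sub>0(\<Omega>)\<close>; functions
  are extended by zero from the polyhedron to \<open>\<Omega>\<close>.\<close>

definition P1_space :: "(real^'d) set \<Rightarrow> (real^'d) set set \<Rightarrow> (real^'d \<Rightarrow> real) set" where
  "P1_space \<Omega> \<T> = {v \<in> H10_space \<Omega>. continuous_on (closure \<Omega>) v \<and>
     (\<forall>K\<in>\<T>. \<exists>a c. \<forall>x\<in>K. v x = a \<bullet> x + c) \<and>
     (\<forall>x\<in>\<Omega> - \<Union>\<T>. v x = 0)}"

definition is_ritz_projection ::
  "(real^'d) set \<Rightarrow> (real^'d \<Rightarrow> real) set \<Rightarrow> (real^'d \<Rightarrow> real) \<Rightarrow> (real^'d \<Rightarrow> real) \<Rightarrow> bool" where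
  "is_ritz_projection \<Omega> X w p \<longleftrightarrow> p \<in> X \<and>
     (\<forall>v\<in>X. L2_inner \<Omega> (wgrad \<Omega> p) (wgrad \<Omega> v) = L2_inner \<Omega> (wgrad \<Omega> w) (wgrad \<Omega> v))"

definition is_L2_projection ::
  "(real^'d) set \<Rightarrow> (real^'d \<Rightarrow> real) set \<Rightarrow> (real^'d \<Rightarrow> real) \<Rightarrow> (real^'d \<Rightarrow> real) \<Rightarrow> bool" where
  "is_L2_projection \<Omega> X w p \<longleftrightarrow> p \<in> X \<and> (\<forall>v\<in>X. L2_inner \<Omega> p v = L2_inner \<Omega> w v)"

section \<open>The memory operator\<close>

definition Bform ::
  "(real^'d) set \<Rightarrow> (real^'d \<Rightarrow> real \<Rightarrow> real \<Rightarrow> real^'d^'d) \<Rightarrow>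
   (real^'d \<Rightarrow> real \<Rightarrow> real \<Rightarrow> real^'d) \<Rightarrow> (real^'d \<Rightarrow> real \<Rightarrow> real \<Rightarrow> real) \<Rightarrow>
   real \<Rightarrow> real \<Rightarrow> (real^'d \<Rightarrow> real) \<Rightarrow> (real^'d \<Rightarrow> real) \<Rightarrow> real" where
  "Bform \<Omega> b2 b1 b0 t s w v =
     L2_inner \<Omega> (\<lambda>x. b2 x t s *v wgrad \<Omega> w x) (wgrad \<Omega> v)
     - L2_inner \<Omega> (\<lambda>x. w x *\<^sub>R b1 x t s) (wgrad \<Omega> v)
     + L2_inner \<Omega> (\<lambda>x. b0 x t s * w x) v"

definition smooth_coefficient ::
  "(real^'d) set \<Rightarrow> real \<Rightarrow> (real^'d \<Rightarrow> real \<Rightarrow> real \<Rightarrow> real) \<Rightarrow> bool" where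
  "smooth_coefficient \<Omega> T b \<longleftrightarrow>
     smooth_on_closed (closure \<Omega> \<times> {0..T} \<times> {0..T}) (\<lambda>(x, t, s). b x t s)"

section \<open>Time discretization\<close>

definition tnode :: "real \<Rightarrow> real \<Rightarrow> nat \<Rightarrow> nat \<Rightarrow> real" where
  "tnode T \<delta> N n = T * (real n / real N) powr \<delta>"

definition tstep :: "real \<Rightarrow> real \<Rightarrow> nat \<Rightarrow> nat \<Rightarrow> real" where
  "tstep T \<delta> N n = tnode T \<delta> N n - tnode T \<delta> N (n - 1)"

definition L1_weight :: "real \<Rightarrow> real \<Rightarrow> real \<Rightarrow> nat \<Rightarrow> nat \<Rightarrow> nat \<Rightarrow> real" where
  "L1_weight T \<alpha> \<delta> N n j =
     inverse (tstep T \<delta> N j) / Gamma (1 - \<alpha>) *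
     integral {tnode T \<delta> N (j - 1)..tnode T \<delta> N j} (\<lambda>s. (tnode T \<delta> N n - s) powr (- \<alpha>))"

definition L1_caputo ::
  "real \<Rightarrow> real \<Rightarrow> real \<Rightarrow> nat \<Rightarrow> (nat \<Rightarrow> 'a \<Rightarrow> real) \<Rightarrow> nat \<Rightarrow> 'a \<Rightarrow> real" where
  "L1_caputo T \<alpha> \<delta> N w n x =
     (\<Sum>j=1..n. L1_weight T \<alpha> \<delta> N n j * (w j x - w (j - 1) x))"

text \<open>\<open>extrapolation T \<delta> N u n\<close> is the extrapolated value written with superscript
  \<open>n - 1\<close> in the literature: it approximates \<open>u n\<close> from \<open>u (n - 1)\<close> and \<open>u (n - 2)\<close>, for
  \<open>n \<ge> 2\<close>.\<close>

definition extrapolation ::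
  "real \<Rightarrow> real \<Rightarrow> nat \<Rightarrow> (nat \<Rightarrow> 'a \<Rightarrow> real) \<Rightarrow> nat \<Rightarrow> 'a \<Rightarrow> real" where
  "extrapolation T \<delta> N u n x =
     (1 + tstep T \<delta> N n / tstep T \<delta> N (n - 1)) * u (n - 1) x
     - tstep T \<delta> N n / tstep T \<delta> N (n - 1) * u (n - 2) x"

definition Bbar ::
  "(real \<Rightarrow> real \<Rightarrow> (real^'d \<Rightarrow> real) \<Rightarrow> (real^'d \<Rightarrow> real) \<Rightarrow> real) \<Rightarrow> (nat \<Rightarrow> real) \<Rightarrow>
   (nat \<Rightarrow> real^'d \<Rightarrow> real) \<Rightarrow> nat \<Rightarrow> nat \<Rightarrow> (real^'d \<Rightarrow> real) \<Rightarrow> real" where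
  "Bbar B t u n j v =
     (if j = n - 1 then B (t n) (t j) (u j) v
      else (B (t n) (t j) (u j) v + B (t n) (t (j + 1)) (u (j + 1)) v) / 2)"

definition fully_discrete_solution ::
  "(real^'d) set \<Rightarrow> real \<Rightarrow> real \<Rightarrow> real \<Rightarrow> (real \<Rightarrow> real) \<Rightarrow>
   (real^'d \<Rightarrow> real \<Rightarrow> real \<Rightarrow> real^'d^'d) \<Rightarrow> (real^'d \<Rightarrow> real \<Rightarrow> real \<Rightarrow> real^'d) \<Rightarrow>
   (real^'d \<Rightarrow> real \<Rightarrow> real \<Rightarrow> real) \<Rightarrow> (real^'d \<Rightarrow> real) \<Rightarrow> (real \<Rightarrow> real^'d \<Rightarrow> real) \<Rightarrow>
   nat \<Rightarrow> (real^'d \<Rightarrow> real) set \<Rightarrow> (nat \<Rightarrow> real^'d \<Rightarrow> real) \<Rightarrow> bool" where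
  "fully_discrete_solution \<Omega> T \<alpha> \<delta> M b2 b1 b0 u0 f N X u \<longleftrightarrow>
     (let t = tnode T \<delta> N; \<tau> = tstep T \<delta> N; B = Bform \<Omega> b2 b1 b0 in
      is_ritz_projection \<Omega> X u0 (u 0) \<and>
      (\<forall>n\<in>{1..N}. u n \<in> X) \<and>
      (\<exists>fh. (\<forall>n\<in>{1..N}. is_L2_projection \<Omega> X (f (t n)) (fh n)) \<and>
        (\<forall>v\<in>X.
           L2_inner \<Omega> (L1_caputo T \<alpha> \<delta> N u 1) v
           + M ((L2_norm \<Omega> (wgrad \<Omega> (u 1)))\<^sup>2) * L2_inner \<Omega> (wgrad \<Omega> (u 1)) (wgrad \<Omega> v)
           = L2_inner \<Omega> (fh 1) v + \<tau> 1 * B (t 1) (t 1) (u 1) v) \<and>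
        (\<forall>n\<in>{2..N}. \<forall>v\<in>X.
           L2_inner \<Omega> (L1_caputo T \<alpha> \<delta> N u n) v
           + M ((L2_norm \<Omega> (wgrad \<Omega> (extrapolation T \<delta> N u n)))\<^sup>2)
             * L2_inner \<Omega> (wgrad \<Omega> (u n)) (wgrad \<Omega> v)
           = L2_inner \<Omega> (fh n) v + (\<Sum>j=1..n-1. \<tau> (j + 1) * Bbar B t u n j v))))"

definition step_norm ::
  "(real^'d) set \<Rightarrow> real \<Rightarrow> real \<Rightarrow> real \<Rightarrow> nat \<Rightarrow> nat \<Rightarrow> (real^'d \<Rightarrow> real) \<Rightarrow> real" where
  "step_norm \<Omega> T \<alpha> \<delta> N n w =
     L2_norm \<Omega> w + (tstep T \<delta> N n) powr (\<alpha> / 2) * L2_norm \<Omega> (wgrad \<Omega> w)"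

end

theory Submission
  imports Defs
begin

text \<open>Testing the scheme at level \<open>n\<close> with \<open>u\<^sub>h\<^sup>n\<close> bounds
  \<open>D y n + m\<^sub>0 g n\<close>, where \<open>y n\<close> and \<open>g n\<close> are the squared \<open>L\<^sup>2\<close> norms of \<open>u\<^sub>h\<^sup>n\<close> and of its
  gradient and \<open>D\<close> is the L1 operator, by the data plus the memory \<open>\<Sum>j<n. \<tau>\<^sub>j\<^sub>+\<^sub>1 g j\<close>.
  For \<open>n = 1\<close> the implicit memory term is absorbed when \<open>N\<close> is large.

  To control the memory, sum with weights \<open>q n\<close> proportional to \<open>n powr ((\<delta> - 1) * \<alpha>)\<close>. They dominate the
  steps, have bounded sum, and on the graded mesh \<open>q (n+1) * k (n+1) (i+1) \<le> q n * k n i\<close>, so that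
  Abel summation bounds \<open>\<Sum>n. q n * D y n\<close> from below by a multiple of \<open>- y 0\<close>. Gronwall's lemma then
  bounds \<open>\<Sum>n. q n * g n\<close>, hence the memory, and a comparison argument for \<open>D\<close> bounds \<open>y n\<close> and
  \<open>\<tau>\<^sub>n\<^sup>\<alpha> * g n\<close>.\<close>

section \<open>Difference quotients of power functions\<close>

text \<open>The obstacle: the memory carries gradients of all earlier levels, while
  \<open>D y n\<close> has no sign, so the tested scheme does not bound \<open>g n\<close> by itself
  and Gronwall cannot be applied level by level. Summation disposes of \<open>D y n\<close>, but the
  steps \<open>\<tau> n\<close> will not do as weights: \<open>\<tau> n * k n n\<close> is
  proportional to \<open>\<tau> n powr (1 - \<alpha>)\<close>, which increases with \<open>n\<close>
  when \<open>\<delta> > 1\<close> and so violates the shift inequality. The weights have to grow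
  more slowly. Passing from the pair \<open>(n, i)\<close> to \<open>(n + 1, i + 1)\<close>
  stretches the time distances that enter \<open>k\<close> by at least
  \<open>r = ((n + 1) / n) powr (\<delta> - 1)\<close>, and \<open>k\<close> is decreasing and
  homogeneous of degree \<open>- \<alpha>\<close> in these distances. Weights may therefore grow by
  \<open>r powr \<alpha>\<close> per level, which is the origin of the exponent
  \<open>(\<delta> - 1) * \<alpha>\<close>. The power of \<open>N\<close> in \<open>q\<close> is
  then fixed by two demands: \<open>q j\<close> dominates \<open>\<tau> (Suc j)\<close> up to a
  constant, and \<open>q n\<close> is at most \<open>T / N\<close>.\<close>

lemma powr_mvt:
  fixes p :: real
  assumes "0 < p" "0 \<le> x" "x < y"
  obtains z where "x < z" "z < y" "y powr p - x powr p = (y - x) * (p * z powr (p - 1))"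
proof -
  have D: "((\<lambda>t. t powr p) has_real_derivative p * t powr (p - 1)) (at t)" if "x < t" for t
    using that assms by (intro has_real_derivative_powr) simp
  have "\<exists>l z. x < z \<and> z < y \<and> ((\<lambda>t. t powr p) has_real_derivative l) (at z) \<and>
      y powr p - x powr p = (y - x) * l"
  proof (rule MVT)
    \<comment> \<open>The left end may be 0, where \<open>t powr p\<close> need not be
      differentiable; continuity there comes from \<open>0 < p\<close>.\<close>
    show "continuous_on {x..y} (\<lambda>t. t powr p)"
      using assms by (intro continuous_on_powr' continuous_on_id continuous_on_const) auto
    show "(\<lambda>t. t powr p) differentiable (at t)" if "x < t" for t
      using D[OF that] by (rule has_field_derivative_imp_has_derivative[THEN differentiableI])
  qed (use assms in simp)
  then obtain l z where z: "x < z" "z < y" "((\<lambda>t. t powr p) has_real_derivative l) (at z)"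
      "y powr p - x powr p = (y - x) * l"
    by blast
  moreover have "l = p * z powr (p - 1)"
    using DERIV_unique[OF z(3) D[OF z(1)]] .
  ultimately show thesis using that by simp
qed

text \<open>A chord slope of a power function. With exponent \<open>1 - \<alpha>\<close> and the
  distances of two nodes from \<open>t n\<close> it is an L1 weight up to a Gamma factor
  (\<open>L1_weight_slope\<close>), so comparisons of weights become comparisons of chords of a
  concave function.\<close>

definition powr_slope :: "real \<Rightarrow> real \<Rightarrow> real \<Rightarrow> real" where
  "powr_slope p x y = (y powr p - x powr p) / (y - x)"

lemma powr_slope_adjacent:
  assumes "0 < p" "p < 1" "0 \<le> x" "x < t" "t < y"
  shows "powr_slope p t y \<le> powr_slope p x t"
proof -
  obtain z1 where 1: "x < z1" "z1 < t" "t powr p - x powr p = (t - x) * (p * z1 powr (p - 1))"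
    using powr_mvt[of p x t] assms by auto
  obtain z2 where 2: "t < z2" "z2 < y" "y powr p - t powr p = (y - t) * (p * z2 powr (p - 1))"
    using powr_mvt[of p t y] assms by auto
  have "z2 powr (p - 1) \<le> z1 powr (p - 1)"
    using 1 2 assms by (intro powr_mono2') auto
  then show ?thesis
    using 1 2 assms by (simp add: powr_slope_def)
qed

text \<open>Concavity. The ends move one at a time: \<open>m1\<close> cuts the chord from
  \<open>x\<close> to \<open>y'\<close> at \<open>y\<close>, \<open>m2\<close> cuts it at
  \<open>x'\<close>, and in both cases \<open>powr_slope_adjacent\<close> compares the two
  pieces.\<close>

lemma powr_slope_antimono:
  assumes p: "0 < p" "p < 1" and "0 \<le> x" "x \<le> x'" "y \<le> y'" "x < y" "x' < y'"
  shows "powr_slope p x' y' \<le> powr_slope p x y"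
proof -
  have m1: "powr_slope p x y' \<le> powr_slope p x y"
  proof (cases "y = y'")
    case False
    have "powr_slope p y y' \<le> powr_slope p x y"
      using False assms by (intro powr_slope_adjacent) auto
    then have "(y' powr p - y powr p) \<le> powr_slope p x y * (y' - y)"
      using False assms by (simp add: powr_slope_def[of p y y'] pos_divide_le_eq)
    moreover have "(y powr p - x powr p) = powr_slope p x y * (y - x)"
      using assms by (simp add: powr_slope_def)
    ultimately have "y' powr p - x powr p \<le> powr_slope p x y * (y' - x)"
      by (simp add: algebra_simps)
    then show ?thesis
      using assms by (simp add: powr_slope_def[of p x y'] pos_divide_le_eq)
  qed simp
  have m2: "powr_slope p x' y' \<le> powr_slope p x y'"
  proof (cases "x = x'")
    case False
    have "powr_slope p x' y' \<le> powr_slope p x x'"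
      using False assms by (intro powr_slope_adjacent) auto
    then have "powr_slope p x' y' * (x' - x) \<le> (x' powr p - x powr p)"
      using False assms by (simp add: powr_slope_def[of p x x'] pos_le_divide_eq)
    moreover have "(y' powr p - x' powr p) = powr_slope p x' y' * (y' - x')"
      using assms by (simp add: powr_slope_def)
    ultimately have "powr_slope p x' y' * (y' - x) \<le> y' powr p - x powr p"
      by (simp add: algebra_simps)
    then show ?thesis
      using assms by (simp add: powr_slope_def[of p x y'] pos_le_divide_eq)
  qed simp
  from m1 m2 show ?thesis by simp
qed

lemma powr_slope_nonneg: "0 < p \<Longrightarrow> 0 \<le> x \<Longrightarrow> x < y \<Longrightarrow> 0 \<le> powr_slope p x y"
  by (simp add: powr_slope_def powr_mono2)

lemma powr_slope_zero: "0 < y \<Longrightarrow> powr_slope p 0 y = y powr (p - 1)"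
  by (simp add: powr_slope_def powr_diff)

lemma powr_slope_ge:
  assumes "0 < p" "p < 1" "0 \<le> x" "x < y" 
  shows "p * y powr (p - 1) \<le> powr_slope p x y"
proof -
  obtain z where z: "x < z" "z < y" "y powr p - x powr p = (y - x) * (p * z powr (p - 1))"
    using powr_mvt[of p x y] assms by auto
  have "y powr (p - 1) \<le> z powr (p - 1)"
    using z assms by (intro powr_mono2') auto
  then show ?thesis using z assms by (simp add: powr_slope_def)
qed

lemma powr_slope_scale:
  assumes "0 < r" "0 \<le> x" "x < y"
  shows "powr_slope p (r * x) (r * y) = r powr (p - 1) * powr_slope p x y"
proof -
  have "powr_slope p (r * x) (r * y) = (r powr p * (y powr p - x powr p)) / (r * (y - x))"
    using assms by (simp add: powr_slope_def powr_mult right_diff_distrib)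
  also have "\<dots> = r powr (p - 1) * powr_slope p x y"
    using assms by (simp add: powr_slope_def powr_diff)
  finally show ?thesis .
qed

text \<open>The core of all mesh comparisons: consecutive graded steps grow at least like the
  density of the grading. The claim is \<open>H (l - 1) \<le> H l\<close>, and \<open>H\<close>
  increases there because \<open>(l + 1) / l * x \<le> x + 1\<close> for
  \<open>x \<le> l\<close>.\<close>

lemma powr_step_ratio:
  fixes d l :: real
  assumes "1 \<le> d" "1 \<le> l"
  shows "((l + 1) / l) powr (d - 1) * (l powr d - (l - 1) powr d) \<le> (l + 1) powr d - l powr d"
proof -
  define \<rho> where "\<rho> = ((l + 1) / l) powr (d - 1)"
  define H where "H x = (x + 1) powr d - \<rho> * x powr d" for x
  have "H (l - 1) \<le> H l"
  proof (rule DERIV_nonneg_imp_increasing_open[of "l - 1" l H])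
    show "continuous_on {l - 1..l} H"
      unfolding H_def using assms by (auto intro!: continuous_intros continuous_on_powr')
    fix x assume x: "l - 1 < x" "x < l"
    have x0: "0 < x" using x assms by auto
    have "(H has_real_derivative d * (x + 1) powr (d - 1) - \<rho> * (d * x powr (d - 1))) (at x)"
      unfolding H_def using x0 by (auto intro!: derivative_eq_intros)
    moreover have "\<rho> * x powr (d - 1) \<le> (x + 1) powr (d - 1)"
    proof -
      have "\<rho> * x powr (d - 1) = ((l + 1) / l * x) powr (d - 1)"
        unfolding \<rho>_def using x0 assms by (simp add: powr_mult[symmetric])
      also have "\<dots> \<le> (x + 1) powr (d - 1)"
        using x x0 assms by (intro powr_mono2) (auto simp: field_simps)
      finally show ?thesis .
    qed
    then have "0 \<le> d * ((x + 1) powr (d - 1) - \<rho> * x powr (d - 1))" using assms by simp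
    ultimately show "\<exists>y. (H has_real_derivative y) (at x) \<and> 0 \<le> y"
      by (auto simp: algebra_simps)
  qed simp
  then show ?thesis unfolding \<rho>_def[symmetric] by (simp add: H_def algebra_simps)
qed

section \<open>The L1 operator on graded meshes\<close>

locale graded_mesh =
  fixes T \<alpha> \<delta> :: real and N :: nat
  assumes T: "0 < T" and \<alpha>: "0 < \<alpha>" "\<alpha> < 1" and \<delta>: "1 \<le> \<delta>" and N: "1 \<le> N"
begin

abbreviation "t \<equiv> tnode T \<delta> N"
abbreviation "\<tau> \<equiv> tstep T \<delta> N"
abbreviation "k \<equiv> L1_weight T \<alpha> \<delta> N"

lemma t_0: "t 0 = 0"
  using \<delta> by (simp add: tnode_def)

lemma t_N: "t N = T"
  using N by (simp add: tnode_def)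

lemma t_less: "i < j \<Longrightarrow> t i < t j"
  unfolding tnode_def using T N \<delta> by (simp add: powr_less_mono2 divide_strict_right_mono)

lemma t_le: "i \<le> j \<Longrightarrow> t i \<le> t j"
  using t_less[of i j] by (cases "i = j") auto

lemma t_pos: "1 \<le> n \<Longrightarrow> 0 < t n"
  using t_less[of 0 n] t_0 by simp

lemma t_le_T: "n \<le> N \<Longrightarrow> t n \<le> T"
  using t_le[of n N] t_N by simp

lemma \<tau>_pos: "1 \<le> n \<Longrightarrow> 0 < \<tau> n"
  using t_less[of "n - 1" n] by (simp add: tstep_def)

lemma L1_weight_slope:
  assumes "1 \<le> j" "j \<le> n"
  shows "k n j = powr_slope (1 - \<alpha>) (t n - t j) (t n - t (j - 1)) / Gamma (2 - \<alpha>)"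
proof -
  have lt: "t (j - 1) < t j" using assms by (intro t_less) auto
  have le: "t j \<le> t n" using assms by (intro t_le)
  have "((\<lambda>s. (t n - s) powr (- \<alpha>)) has_integral
      - ((t n - t j) powr (1 - \<alpha>)) / (1 - \<alpha>) - - ((t n - t (j - 1)) powr (1 - \<alpha>)) / (1 - \<alpha>))
      {t (j - 1)..t j}"
  \<comment> \<open>For \<open>j = n\<close> the integrand is singular at the right end, so the
    derivative of the primitive is only available inside the interval.\<close>
  proof (rule fundamental_theorem_of_calculus_interior)
    show "continuous_on {t (j - 1)..t j} (\<lambda>s. - ((t n - s) powr (1 - \<alpha>)) / (1 - \<alpha>))"
      using le \<alpha> by (auto intro!: continuous_intros continuous_on_powr')
    fix s assume s: "s \<in> {t (j - 1)<..<t j}"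
    have "((\<lambda>s. (t n - s) powr (1 - \<alpha>)) has_real_derivative - ((1 - \<alpha>) * (t n - s) powr (- \<alpha>))) (at s)"
      using s le \<alpha> by (auto intro!: derivative_eq_intros)
    then have "((\<lambda>s. - ((t n - s) powr (1 - \<alpha>)) / (1 - \<alpha>)) has_real_derivative
        - (- ((1 - \<alpha>) * (t n - s) powr (- \<alpha>))) / (1 - \<alpha>)) (at s)"
      by (intro DERIV_cdivide DERIV_minus)
    then have "((\<lambda>s. - ((t n - s) powr (1 - \<alpha>)) / (1 - \<alpha>)) has_real_derivative (t n - s) powr (- \<alpha>)) (at s)"
      using \<alpha> by simp
    then show "((\<lambda>s. - ((t n - s) powr (1 - \<alpha>)) / (1 - \<alpha>)) has_vector_derivative (t n - s) powr (- \<alpha>)) (at s)"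
      by (simp add: has_real_derivative_iff_has_vector_derivative)
  qed (use lt in simp)
  then have I: "integral {t (j - 1)..t j} (\<lambda>s. (t n - s) powr (- \<alpha>)) =
      ((t n - t (j - 1)) powr (1 - \<alpha>) - (t n - t j) powr (1 - \<alpha>)) / (1 - \<alpha>)"
    by (simp add: integral_unique diff_divide_distrib)
  have "Gamma (1 - \<alpha> + 1) = (1 - \<alpha>) * Gamma (1 - \<alpha>)"
    using \<alpha> by (intro Gamma_plus1) (auto elim!: nonpos_Ints_cases)
  then have G: "Gamma (2 - \<alpha>) = (1 - \<alpha>) * Gamma (1 - \<alpha>)" by simp
  show ?thesis
    unfolding L1_weight_def I powr_slope_def G tstep_def
    by (simp add: divide_inverse mult_ac)
qed

lemma Gamma_pos: "0 < Gamma (2 - \<alpha>)"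
  using \<alpha> by (intro Gamma_real_pos) auto

lemma L1_weight_nonneg: "1 \<le> j \<Longrightarrow> j \<le> n \<Longrightarrow> 0 \<le> k n j"
  using \<alpha> Gamma_pos t_le[of j n] t_less[of "j - 1" j]
  by (auto simp: L1_weight_slope intro!: divide_nonneg_pos powr_slope_nonneg)

lemma L1_weight_mono:
  assumes "1 \<le> j" "j < n" shows "k n j \<le> k n (Suc j)"
proof -
  have "powr_slope (1 - \<alpha>) (t n - t j) (t n - t (j - 1))
      \<le> powr_slope (1 - \<alpha>) (t n - t (Suc j)) (t n - t j)"
    using \<alpha> assms t_le[of "Suc j" n] t_less[of "j - 1" j] t_less[of j "Suc j"]
    by (intro powr_slope_antimono) auto
  then show ?thesis
    using assms Gamma_pos by (simp add: L1_weight_slope divide_right_mono)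
qed

text \<open>The chord starts at 0, so its slope is a pure power. This weight is the source of the
  factor \<open>\<tau> n powr \<alpha>\<close> in front of the squared gradient norm.\<close>

lemma L1_weight_diag: "1 \<le> n \<Longrightarrow> k n n = \<tau> n powr (- \<alpha>) / Gamma (2 - \<alpha>)"
  using \<tau>_pos[of n] by (simp add: L1_weight_slope tstep_def powr_slope_zero)

text \<open>The L1 operator maps the sequence 0, 1, 1, ... to \<open>k n 1\<close>. A lower bound
  that depends on neither \<open>n\<close> nor \<open>N\<close> makes a constant usable as upper
  barrier in the comparison argument of \<open>L1_energy_stability\<close>.\<close>

lemma L1_weight_first_ge:
  assumes "1 \<le> n" "n \<le> N"
  shows "(1 - \<alpha>) * T powr (- \<alpha>) / Gamma (2 - \<alpha>) \<le> k n 1"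
proof -
  have "T powr (- \<alpha>) \<le> t n powr (- \<alpha>)"
    using assms t_pos[of n] t_le_T[of n] \<alpha> by (intro powr_mono2') auto
  moreover have "(1 - \<alpha>) * t n powr ((1 - \<alpha>) - 1) \<le> powr_slope (1 - \<alpha>) (t n - t 1) (t n)"
    using assms \<alpha> t_le[of 1 n] t_pos[of 1] by (intro powr_slope_ge) auto
  ultimately have "(1 - \<alpha>) * T powr (- \<alpha>) \<le> powr_slope (1 - \<alpha>) (t n - t 1) (t n)"
    using \<alpha> by (smt (verit) mult_left_mono)
  then show ?thesis
    using assms Gamma_pos t_0 by (simp add: L1_weight_slope divide_right_mono)
qed

lemma L1_weight_first_le:
  assumes "1 \<le> n"
  shows "k n 1 \<le> t n powr (- \<alpha>) / Gamma (2 - \<alpha>)"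
proof -
  have "powr_slope (1 - \<alpha>) (t n - t 1) (t n) \<le> powr_slope (1 - \<alpha>) 0 (t n)"
    using assms \<alpha> t_le[of 1 n] t_pos[of 1] t_pos[of n] by (intro powr_slope_antimono) auto
  then show ?thesis
    using assms Gamma_pos t_0 t_pos[of n] by (simp add: L1_weight_slope divide_right_mono powr_slope_zero)
qed

section \<open>Growth of the mesh steps and the summation weights\<close>

lemma \<tau>_ratio:
  assumes "1 \<le> l"
  shows "((real l + 1) / real l) powr (\<delta> - 1) * \<tau> l \<le> \<tau> (Suc l)"
proof -
  have e: "\<tau> (Suc l) = T / real N powr \<delta> * ((real l + 1) powr \<delta> - real l powr \<delta>)"
    "\<tau> l = T / real N powr \<delta> * (real l powr \<delta> - (real l - 1) powr \<delta>)"
    using assms N by (auto simp: tstep_def tnode_def powr_divide right_diff_distrib add.commute of_nat_diff)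
  have "T / real N powr \<delta> * (((real l + 1) / real l) powr (\<delta> - 1) * (real l powr \<delta> - (real l - 1) powr \<delta>))
    \<le> T / real N powr \<delta> * ((real l + 1) powr \<delta> - real l powr \<delta>)"
    using assms \<delta> T by (intro mult_left_mono powr_step_ratio) auto
  then show ?thesis unfolding e by (simp add: mult_ac)
qed

text \<open>The growth ratio decreases with the index, so the ratio at the last level
  \<open>n\<close> serves for all earlier steps at once.\<close>

lemma \<tau>_ratio_uniform:
  assumes "1 \<le> l" "l \<le> n"
  shows "((real n + 1) / real n) powr (\<delta> - 1) * \<tau> l \<le> \<tau> (Suc l)"
proof -
  have "((real n + 1) / real n) powr (\<delta> - 1) \<le> ((real l + 1) / real l) powr (\<delta> - 1)"
    using assms \<delta> by (intro powr_mono2) (auto simp: field_simps)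
  then have "((real n + 1) / real n) powr (\<delta> - 1) * \<tau> l \<le> ((real l + 1) / real l) powr (\<delta> - 1) * \<tau> l"
    using \<tau>_pos[OF assms(1)] by (intro mult_right_mono) auto
  with \<tau>_ratio[OF assms(1)] show ?thesis by simp
qed

text \<open>Sum of \<open>\<tau>_ratio_uniform\<close> over the steps between \<open>t i\<close> and
  \<open>t n\<close>. The stretching factor depends on \<open>n\<close> only, hence is the same for
  both ends of the chord behind \<open>k n i\<close>.\<close>

lemma t_diff_ratio:
  assumes "i \<le> n" "1 \<le> n"
  shows "((real n + 1) / real n) powr (\<delta> - 1) * (t n - t i) \<le> t (Suc n) - t (Suc i)"
proof -
  have "((real n + 1) / real n) powr (\<delta> - 1) * (t m - t i) \<le> t (Suc m) - t (Suc i)" if "i \<le> m" "m \<le> n" for m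
    using that
  proof (induction m rule: dec_induct)
    case (step m)
    have "((real n + 1) / real n) powr (\<delta> - 1) * (t (Suc m) - t m) \<le> t (Suc (Suc m)) - t (Suc m)"
      using \<tau>_ratio_uniform[of "Suc m" n] step by (simp add: tstep_def)
    with step show ?case by (simp add: algebra_simps)
  qed simp
  then show ?thesis using assms by blast
qed

text \<open>From \<open>n\<close> to \<open>n + 1\<close> this grows exactly by the power
  \<open>\<alpha>\<close> of the stretching factor of \<open>t_diff_ratio\<close>. The power of
  \<open>N\<close> supplies the missing part of a mesh step, see \<open>\<tau>_le_q\<close>.\<close>

definition q :: "nat \<Rightarrow> real" where
  "q n = T * real n powr ((\<delta> - 1) * \<alpha>) * real N powr ((\<delta> - 1) * (1 - \<alpha>) - \<delta>)"

lemma q_nonneg: "0 \<le> q n"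
  using T by (simp add: q_def)

text \<open>The chord for \<open>(n + 1, i + 1)\<close> lies to the right of the chord for
  \<open>(n, i)\<close> scaled by \<open>r\<close>. Concavity and homogeneity thus cost a factor
  \<open>r powr (- \<alpha>)\<close>, which the growth of \<open>q\<close> by
  \<open>r powr \<alpha>\<close> cancels.\<close>

lemma q_weight_shift:
  assumes "1 \<le> i" "i \<le> n"
  shows "q (Suc n) * k (Suc n) (Suc i) \<le> q n * k n i"
proof -
  define r where "r = ((real n + 1) / real n) powr (\<delta> - 1)"
  have n: "1 \<le> n" using assms by simp
  have r: "0 < r" using n by (simp add: r_def)
  have "powr_slope (1 - \<alpha>) (t (Suc n) - t (Suc i)) (t (Suc n) - t i)
    \<le> powr_slope (1 - \<alpha>) (r * (t n - t i)) (r * (t n - t (i - 1)))"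
  proof (rule powr_slope_antimono)
    show "r * (t n - t i) \<le> t (Suc n) - t (Suc i)" "r * (t n - t (i - 1)) \<le> t (Suc n) - t i"
      unfolding r_def using t_diff_ratio[of i n] t_diff_ratio[of "i - 1" n] assms by auto
    show "0 \<le> r * (t n - t i)" using r t_le[of i n] assms by simp
    show "r * (t n - t i) < r * (t n - t (i - 1))"
      using r t_less[of "i - 1" i] assms by simp
    show "t (Suc n) - t (Suc i) < t (Suc n) - t i" using t_less[of i "Suc i"] by simp
  qed (use \<alpha> in auto)
  also have "\<dots> = r powr (- \<alpha>) * powr_slope (1 - \<alpha>) (t n - t i) (t n - t (i - 1))"
    using r t_le[of i n] t_less[of "i - 1" i] assms by (subst powr_slope_scale) auto
  finally have "k (Suc n) (Suc i) \<le> r powr (- \<alpha>) * k n i"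
    using assms Gamma_pos by (simp add: L1_weight_slope divide_right_mono)
  then have "q (Suc n) * k (Suc n) (Suc i) \<le> q (Suc n) * (r powr (- \<alpha>) * k n i)"
    by (intro mult_left_mono q_nonneg)
  also have "q (Suc n) * (r powr (- \<alpha>) * k n i) = (r powr \<alpha> * q n) * (r powr (- \<alpha>) * k n i)"
  proof -
    have "r powr \<alpha> = (real n + 1) powr ((\<delta> - 1) * \<alpha>) / real n powr ((\<delta> - 1) * \<alpha>)"
      unfolding r_def using n by (simp add: powr_powr powr_divide)
    then have "q (Suc n) = r powr \<alpha> * q n" using n by (simp add: q_def add.commute)
    then show ?thesis by simp
  qed
  also have "\<dots> = q n * k n i"
    using r by (simp add: powr_minus)
  finally show ?thesis .
qed

text \<open>By concavity each summand is at most an increment of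
  \<open>n powr (1 - \<alpha>) / (1 - \<alpha>)\<close>.\<close>

lemma sum_powr_minus_le: "(\<Sum>n=1..m. real n powr (- \<alpha>)) \<le> real m powr (1 - \<alpha>) / (1 - \<alpha>)"
proof (induction m)
  case (Suc m)
  have "(1 - \<alpha>) * real (Suc m) powr ((1 - \<alpha>) - 1) \<le> powr_slope (1 - \<alpha>) (real m) (real (Suc m))"
    using \<alpha> by (intro powr_slope_ge) auto
  then have "real (Suc m) powr (- \<alpha>) \<le> (real (Suc m) powr (1 - \<alpha>) - real m powr (1 - \<alpha>)) / (1 - \<alpha>)"
    using \<alpha> by (simp add: powr_slope_def pos_le_divide_eq mult.commute)
  with Suc show ?case by (simp add: diff_divide_distrib)
qed simp

text \<open>Once \<open>n\<close> is replaced by \<open>N\<close>, the exponents of \<open>N\<close>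
  in \<open>q\<close> add up to -1, so \<open>q n \<le> T / N\<close>.\<close>

lemma sum_q_le: "m \<le> N \<Longrightarrow> (\<Sum>n=1..m. q n) \<le> T"
proof -
  assume m: "m \<le> N"
  have "(\<Sum>n=1..m. q n) \<le> (\<Sum>n=1..m. T / real N)"
  proof (rule sum_mono)
    fix n assume n: "n \<in> {1..m}"
    have "q n \<le> T * real N powr ((\<delta> - 1) * \<alpha>) * real N powr ((\<delta> - 1) * (1 - \<alpha>) - \<delta>)"
      unfolding q_def using n m T \<alpha> \<delta> by (intro mult_right_mono mult_left_mono powr_mono2) auto
    also have "\<dots> = T * real N powr ((\<delta> - 1) * \<alpha> + ((\<delta> - 1) * (1 - \<alpha>) - \<delta>))"
      by (simp only: mult.assoc powr_add)
    also have "(\<delta> - 1) * \<alpha> + ((\<delta> - 1) * (1 - \<alpha>) - \<delta>) = -1" by algebra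
    also have "T * real N powr (-1) = T / real N" using N by (simp add: powr_minus_divide)
    finally show "q n \<le> T / real N" .
  qed
  also have "\<dots> = real m * (T / real N)" by simp
  also have "\<dots> \<le> T" using m T N by (simp add: field_simps)
  finally show ?thesis .
qed

text \<open>This sum is the coefficient of \<open>y 0\<close> that Abel summation leaves behind. In
  \<open>q n * t n powr (- \<alpha>)\<close> the grading exponent cancels and
  \<open>n powr (- \<alpha>) * N powr (\<alpha> - 1)\<close> remains, whose sum is bounded uniformly
  in \<open>N\<close>.\<close>

lemma sum_q_weight_first_le:
  assumes "m \<le> N"
  shows "(\<Sum>n=1..m. q n * k n 1) \<le> T powr (1 - \<alpha>) / ((1 - \<alpha>) * Gamma (2 - \<alpha>))"
proof -
  have "q n * k n 1 \<le> T powr (1 - \<alpha>) * real N powr (\<alpha> - 1) / Gamma (2 - \<alpha>) * real n powr (- \<alpha>)" if "n \<in> {1..m}" for n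
  proof -
    have "q n * k n 1 \<le> q n * (t n powr (- \<alpha>) / Gamma (2 - \<alpha>))"
      using that by (intro mult_left_mono q_nonneg L1_weight_first_le) auto
    also have "t n powr (- \<alpha>) = T powr (- \<alpha>) * real n powr (- \<delta> * \<alpha>) * real N powr (\<delta> * \<alpha>)"
    proof -
      have "t n powr (- \<alpha>) = T powr (- \<alpha>) * (real n powr (- \<delta> * \<alpha>) / real N powr (- \<delta> * \<alpha>))"
        unfolding tnode_def using T by (simp add: powr_mult powr_divide powr_powr)
      then show ?thesis by (simp add: powr_minus_divide)
    qed
    also have "q n * (T powr (- \<alpha>) * real n powr (- \<delta> * \<alpha>) * real N powr (\<delta> * \<alpha>) / Gamma (2 - \<alpha>))
      = (T powr 1 * T powr (- \<alpha>)) * (real N powr ((\<delta> - 1) * (1 - \<alpha>) - \<delta>) * real N powr (\<delta> * \<alpha>))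
        / Gamma (2 - \<alpha>) * (real n powr ((\<delta> - 1) * \<alpha>) * real n powr (- \<delta> * \<alpha>))"
      using T by (simp add: q_def)
    also have "\<dots> = T powr (1 - \<alpha>) * real N powr (\<alpha> - 1) / Gamma (2 - \<alpha>) * real n powr (- \<alpha>)"
    proof -
      have "(\<delta> - 1) * (1 - \<alpha>) - \<delta> + \<delta> * \<alpha> = \<alpha> - 1" "(\<delta> - 1) * \<alpha> + - \<delta> * \<alpha> = - \<alpha>" "1 + - \<alpha> = 1 - \<alpha>"
        by algebra+
      then show ?thesis unfolding powr_add[symmetric] by simp
    qed
    finally show ?thesis .
  qed
  then have "(\<Sum>n=1..m. q n * k n 1) \<le> T powr (1 - \<alpha>) * real N powr (\<alpha> - 1) / Gamma (2 - \<alpha>) * (\<Sum>n=1..m. real n powr (- \<alpha>))"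
    unfolding sum_distrib_left by (intro sum_mono)
  also have "\<dots> \<le> T powr (1 - \<alpha>) * real N powr (\<alpha> - 1) / Gamma (2 - \<alpha>) * (real N powr (1 - \<alpha>) / (1 - \<alpha>))"
  proof (rule mult_left_mono)
    have "real m powr (1 - \<alpha>) / (1 - \<alpha>) \<le> real N powr (1 - \<alpha>) / (1 - \<alpha>)"
      using assms \<alpha> by (intro divide_right_mono powr_mono2) auto
    then show "(\<Sum>n=1..m. real n powr (- \<alpha>)) \<le> real N powr (1 - \<alpha>) / (1 - \<alpha>)"
      using sum_powr_minus_le[of m] by linarith
  qed (use Gamma_pos T in simp)
  also have "\<dots> = T powr (1 - \<alpha>) / ((1 - \<alpha>) * Gamma (2 - \<alpha>)) * (real N powr (\<alpha> - 1) * real N powr (1 - \<alpha>))"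
    by (simp add: mult_ac)
  also have "real N powr (\<alpha> - 1) * real N powr (1 - \<alpha>) = 1"
    unfolding powr_add[symmetric] using N by simp
  finally show ?thesis by simp
qed

text \<open>The mean value theorem gives a step of order \<open>z powr (\<delta> - 1)\<close> with
  \<open>z < j + 1 \<le> 2 * j\<close>, whence the power of 2. Of the exponent
  \<open>\<delta> - 1\<close> the share \<open>\<alpha>\<close> is kept on \<open>j\<close>; in the
  share \<open>1 - \<alpha>\<close> the base \<open>j\<close> is enlarged to
  \<open>N\<close>.\<close>

lemma \<tau>_le_q:
  assumes "1 \<le> j" "j < N"
  shows "\<tau> (Suc j) \<le> \<delta> * 2 powr (\<delta> - 1) * q j"
proof -
  have "\<tau> (Suc j) = T / real N powr \<delta> * (real (Suc j) powr \<delta> - real j powr \<delta>)"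
    (is "_ = ?c * _")
    using N by (simp add: tstep_def tnode_def powr_divide right_diff_distrib)
  moreover obtain z where z: "real j < z" "z < real (Suc j)"
    "real (Suc j) powr \<delta> - real j powr \<delta> = (real (Suc j) - real j) * (\<delta> * z powr (\<delta> - 1))"
    using powr_mvt[of \<delta> "real j" "real (Suc j)"] \<delta> by auto
  ultimately have \<tau>: "\<tau> (Suc j) = ?c * (\<delta> * z powr (\<delta> - 1))" by simp
  have "z powr (\<delta> - 1) \<le> (2 * real j) powr (\<delta> - 1)"
    using z assms \<delta> by (intro powr_mono2) auto
  also have "\<dots> = 2 powr (\<delta> - 1) * (real j powr ((\<delta> - 1) * (1 - \<alpha>)) * real j powr ((\<delta> - 1) * \<alpha>))"
  proof -
    have "(\<delta> - 1) * (1 - \<alpha>) + (\<delta> - 1) * \<alpha> = \<delta> - 1" by algebra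
    then show ?thesis unfolding powr_add[symmetric] by (simp add: powr_mult)
  qed
  also have "\<dots> \<le> 2 powr (\<delta> - 1) * (real N powr ((\<delta> - 1) * (1 - \<alpha>)) * real j powr ((\<delta> - 1) * \<alpha>))"
    using assms \<delta> \<alpha> by (intro mult_left_mono mult_right_mono powr_mono2) auto
  finally have "\<tau> (Suc j) \<le> ?c * (\<delta> * (2 powr (\<delta> - 1) * (real N powr ((\<delta> - 1) * (1 - \<alpha>)) * real j powr ((\<delta> - 1) * \<alpha>))))"
    unfolding \<tau> using T \<delta> by (intro mult_left_mono) auto
  also have "\<dots> = \<delta> * 2 powr (\<delta> - 1) * q j"
    by (simp add: q_def powr_diff mult_ac)
  finally show ?thesis .
qed

end

text \<open>Abel summation: replacing the weight of \<open>e n\<close> by the next, larger one only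
  helps. The weights may have any sign, and nothing is asked of the last value \<open>e n\<close>,
  whose sign is still unknown when the comparison argument uses this.\<close>

lemma weighted_telescope_ge:
  fixes k e :: "nat \<Rightarrow> real"
  assumes "1 \<le> n" and "\<And>j. 1 \<le> j \<Longrightarrow> j < n \<Longrightarrow> k j \<le> k (Suc j)" and "\<And>j. j < n \<Longrightarrow> 0 \<le> e j"
  shows "k 1 * e 0 - k n * e n \<le> (\<Sum>j=1..n. k j * (e (j - 1) - e j))"
  using assms
proof (induction n rule: dec_induct)
  case base
  then show ?case by (simp add: right_diff_distrib)
next
  case (step n)
  have "k n * e n \<le> k (Suc n) * e n"
    using step by (intro mult_right_mono) auto
  with step show ?case by (simp add: right_diff_distrib)
qed

text \<open>The induction runs on the right-hand side instead of \<open>w\<close>; one more summand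
  multiplies it by at most \<open>1 + b n \<le> exp (b n)\<close>.\<close>

lemma discrete_Gronwall:
  fixes w b :: "nat \<Rightarrow> real"
  assumes w: "\<And>n. n \<le> m \<Longrightarrow> w n \<le> A + (\<Sum>i<n. b i * w i)" and b: "\<And>i. 0 \<le> b i" and A: "0 \<le> A"
  shows "w m \<le> A * exp (\<Sum>i<m. b i)"
proof -
  have "A + (\<Sum>i<n. b i * w i) \<le> A * exp (\<Sum>i<n. b i)" if "n \<le> m" for n
    using that
  proof (induction n)
    case (Suc n)
    have "A + (\<Sum>i<Suc n. b i * w i) \<le> (A + (\<Sum>i<n. b i * w i)) * (1 + b n)"
      using mult_left_mono[OF w[of n] b[of n]] Suc by (simp add: algebra_simps)
    also have "\<dots> \<le> (A * exp (\<Sum>i<n. b i)) * exp (b n)"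
      using Suc b[of n] A by (intro mult_mono) auto
    finally show ?case by (simp add: exp_add mult.assoc)
  qed simp
  with w[of m] show ?thesis by fastforce
qed

section \<open>Weighted summation and the comparison argument\<close>

context graded_mesh
begin

text \<open>After exchanging the sums, the increments of \<open>y\<close> carry the column sums
  \<open>Q j\<close>. These are nonincreasing, so Abel summation leaves only the two boundary terms,
  and the one with \<open>y m\<close> is nonnegative.\<close>

lemma sum_q_L1_ge:
  assumes "m \<le> N" "\<And>n. 0 \<le> y n"
  shows "- (T powr (1 - \<alpha>) / ((1 - \<alpha>) * Gamma (2 - \<alpha>)) * y 0)
    \<le> (\<Sum>n=1..m. q n * (\<Sum>j=1..n. k n j * (y j - y (j - 1))))"
proof -
  define Q where "Q i = (\<Sum>n=i..m. q n * k n i)" for i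
  have swap: "(\<Sum>n=1..m. q n * (\<Sum>j=1..n. k n j * (y j - y (j - 1)))) = (\<Sum>j=1..m. Q j * (y j - y (j - 1)))"
  proof -
    have "(\<Sum>n=1..m. q n * (\<Sum>j=1..n. k n j * (y j - y (j - 1))))
      = (\<Sum>n=1..m. \<Sum>j | j \<in> {1..m} \<and> j \<le> n. q n * (k n j * (y j - y (j - 1))))"
      unfolding sum_distrib_left by (intro sum.cong) auto
    also have "\<dots> = (\<Sum>j=1..m. \<Sum>n | n \<in> {1..m} \<and> j \<le> n. q n * (k n j * (y j - y (j - 1))))"
      by (intro sum.swap_restrict) auto
    also have "\<dots> = (\<Sum>j=1..m. Q j * (y j - y (j - 1)))"
      unfolding Q_def sum_distrib_right by (intro sum.cong) auto
    finally show ?thesis .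
  qed
  \<comment> \<open>Shifting \<open>n\<close> by one in the sum for \<open>Q (Suc i)\<close> allows
    \<open>q_weight_shift\<close> term by term; \<open>Q i\<close> has the further nonnegative
    summand with \<open>n = m\<close>.\<close>
  have mono: "Q (Suc i) \<le> Q i" if i: "1 \<le> i" "i < m" for i
  proof -
    obtain m' where m': "m = Suc m'" using i by (cases m) auto
    have "Q (Suc i) = (\<Sum>n=i..m'. q (Suc n) * k (Suc n) (Suc i))"
      unfolding Q_def m' by (rule sum.shift_bounds_cl_Suc_ivl)
    also have "\<dots> \<le> (\<Sum>n=i..m'. q n * k n i)"
      using i by (intro sum_mono q_weight_shift) auto
    also have "\<dots> \<le> Q i"
      unfolding Q_def using i m' by (intro sum_mono2) (auto intro!: mult_nonneg_nonneg q_nonneg L1_weight_nonneg)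
    finally show ?thesis .
  qed
  have "- Q 1 * y 0 \<le> (\<Sum>j=1..m. Q j * (y j - y (j - 1)))"
  proof (cases "m = 0")
    case False
    \<comment> \<open>The negated sums \<open>- Q j\<close> are nondecreasing, as
      \<open>weighted_telescope_ge\<close> demands.\<close>
    have "- Q 1 * y 0 - - Q m * y m \<le> (\<Sum>j=1..m. - Q j * (y (j - 1) - y j))"
      using False mono assms by (intro weighted_telescope_ge) auto
    moreover have "0 \<le> Q m * y m"
      unfolding Q_def using assms False by (auto intro!: mult_nonneg_nonneg q_nonneg L1_weight_nonneg)
    ultimately show ?thesis by (simp add: right_diff_distrib sum_subtractf)
  qed (simp add: Q_def)
  moreover have "Q 1 * y 0 \<le> T powr (1 - \<alpha>) / ((1 - \<alpha>) * Gamma (2 - \<alpha>)) * y 0"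
    unfolding Q_def using assms by (intro mult_right_mono sum_q_weight_first_le) auto
  ultimately show ?thesis unfolding swap by simp
qed

text \<open>The first stage bounds the weighted sum \<open>W\<close> by Gronwall, which turns the
  memory into a constant and the right-hand side into \<open>A'\<close>. The second stage uses the
  constant \<open>Y\<close> as a barrier for \<open>y\<close>; it is chosen so that the lower bound
  of \<open>k n 1\<close> times \<open>Y - y 0\<close> equals \<open>A'\<close>.\<close>

lemma L1_energy_stability:
  assumes m: "0 < m" and c: "0 \<le> c" and A: "0 \<le> A"
    and y: "\<And>n. 0 \<le> y n" and g: "\<And>n. 0 \<le> g n"
    and ineq: "\<And>n. 1 \<le> n \<Longrightarrow> n \<le> N \<Longrightarrow>
      (\<Sum>j=1..n. k n j * (y j - y (j - 1))) + m * g n \<le> A + c * (\<Sum>j=1..n-1. \<tau> (Suc j) * g j)"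
    and L: "L = c * (\<delta> * 2 powr (\<delta> - 1))"
    and A': "A' = A + L * ((T powr (1 - \<alpha>) / ((1 - \<alpha>) * Gamma (2 - \<alpha>)) * y 0 + T * A) / m * exp (L / m * T))"
    and Y: "Y = y 0 + A' * (Gamma (2 - \<alpha>) * T powr \<alpha> / (1 - \<alpha>))"
    and n: "1 \<le> n" "n \<le> N"
  shows "y n \<le> Y" and "\<tau> n powr \<alpha> * g n \<le> Y / (m * Gamma (2 - \<alpha>))"
proof -
  define W where "W n = (\<Sum>i=1..n. q i * g i)" for n
  have W0: "0 \<le> W n" for n
    unfolding W_def using g q_nonneg by (intro sum_nonneg) auto
  have L0: "0 \<le> L" using c \<delta> by (simp add: L)
  define E where "E = (T powr (1 - \<alpha>) / ((1 - \<alpha>) * Gamma (2 - \<alpha>)) * y 0 + T * A) / m"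
  have E0: "0 \<le> E" unfolding E_def using y[of 0] A T m \<alpha> Gamma_pos
    by (auto intro!: divide_nonneg_pos add_nonneg_nonneg mult_nonneg_nonneg)
  have mem: "c * (\<Sum>j=1..n-1. \<tau> (Suc j) * g j) \<le> L * W (n - 1)" if "n \<le> N" for n
  proof -
    have "(\<Sum>j=1..n-1. \<tau> (Suc j) * g j) \<le> (\<Sum>j=1..n-1. (\<delta> * 2 powr (\<delta> - 1)) * (q j * g j))"
    proof (rule sum_mono)
      fix j assume "j \<in> {1..n-1}"
      then have "\<tau> (Suc j) \<le> \<delta> * 2 powr (\<delta> - 1) * q j" using that by (intro \<tau>_le_q) auto
      from mult_right_mono[OF this g[of j]] show "\<tau> (Suc j) * g j \<le> (\<delta> * 2 powr (\<delta> - 1)) * (q j * g j)"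
        by (simp add: mult.assoc)
    qed
    from mult_left_mono[OF this c] show ?thesis
      by (simp add: L W_def sum_distrib_left[symmetric] mult.assoc)
  qed
  have ineq': "(\<Sum>j=1..n. k n j * (y j - y (j - 1))) + m * g n \<le> A + L * W (n - 1)" if "1 \<le> n" "n \<le> N" for n
    using ineq[OF that] mem[OF that(2)] by simp
  \<comment> \<open>Multiply by \<open>q n\<close> and sum. The memory at level \<open>n\<close> is
    bounded through \<open>W (n - 1)\<close>, so the recursion is explicit and Gronwall applies for
    every step size.\<close>
  have W_rec: "W M \<le> E + (\<Sum>i<M. (L / m * q (Suc i)) * W i)" if "M \<le> N" for M
  proof -
    have "(\<Sum>n=1..M. q n * ((\<Sum>j=1..n. k n j * (y j - y (j - 1))) + m * g n))
      \<le> (\<Sum>n=1..M. q n * (A + L * W (n - 1)))"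
      using that by (intro sum_mono mult_left_mono ineq' q_nonneg) auto
    moreover have "(\<Sum>n=1..M. q n * ((\<Sum>j=1..n. k n j * (y j - y (j - 1))) + m * g n))
      = (\<Sum>n=1..M. q n * (\<Sum>j=1..n. k n j * (y j - y (j - 1)))) + m * W M"
      by (simp add: W_def distrib_left sum.distrib sum_distrib_left mult_ac)
    moreover have "(\<Sum>n=1..M. q n * (A + L * W (n - 1)))
      = (\<Sum>n=1..M. q n) * A + L * (\<Sum>i<M. q (Suc i) * W i)"
    proof -
      have "(\<Sum>n=1..M. q n * W (n - 1)) = (\<Sum>i<M. q (Suc i) * W i)"
        by (rule sum.reindex_bij_witness[of _ Suc "\<lambda>n. n - 1"]) auto
      moreover have "(\<Sum>n=1..M. q n * (A + L * W (n - 1))) = (\<Sum>n=1..M. q n) * A + L * (\<Sum>n=1..M. q n * W (n - 1))"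
        by (simp add: distrib_left sum.distrib sum_distrib_left sum_distrib_right mult_ac)
      ultimately show ?thesis by simp
    qed
    moreover have "(\<Sum>n=1..M. q n) * A \<le> T * A"
      using sum_q_le[OF that] A by (intro mult_right_mono)
    moreover note sum_q_L1_ge[of M y, OF that y]
    ultimately have "m * W M \<le> m * E + L * (\<Sum>i<M. q (Suc i) * W i)"
      using m by (simp add: E_def)
    then have "m * W M \<le> m * (E + L / m * (\<Sum>i<M. q (Suc i) * W i))"
      using m by (simp add: distrib_left)
    then show ?thesis
      using m by (simp add: sum_distrib_left mult.assoc)
  qed
  have W_le: "W M \<le> E * exp (L / m * T)" if "M \<le> N" for M
  proof -
    have "W M \<le> E * exp (\<Sum>i<M. L / m * q (Suc i))"
      using that W_rec L0 m q_nonneg E0 by (intro discrete_Gronwall) auto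
    also have "(\<Sum>i<M. L / m * q (Suc i)) = L / m * (\<Sum>n=1..M. q n)"
      unfolding sum_distrib_left by (rule sum.reindex_bij_witness[of _ "\<lambda>n. n - 1" Suc]) auto
    also have "E * exp (L / m * (\<Sum>n=1..M. q n)) \<le> E * exp (L / m * T)"
      using sum_q_le[OF that] L0 m E0 by (intro mult_left_mono) (auto intro!: mult_left_mono divide_right_mono)
    finally show ?thesis .
  qed
  have main: "(\<Sum>j=1..n. k n j * (y j - y (j - 1))) + m * g n \<le> A'" if "1 \<le> n" "n \<le> N" for n
  proof -
    have "L * W (n - 1) \<le> L * (E * exp (L / m * T))"
      using that by (intro mult_left_mono W_le L0) auto
    with ineq'[OF that] show ?thesis by (simp add: A' E_def)
  qed
  have A'0: "0 \<le> A'"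
    using A L0 E0 unfolding A' E_def[symmetric] by (intro add_nonneg_nonneg mult_nonneg_nonneg) auto
  \<comment> \<open>The first conjunct is the useful one: as \<open>g n\<close> is nonnegative and
    \<open>k n n\<close> positive, it forces \<open>y n \<le> Y\<close>, and the explicit
    \<open>k n n\<close> later turns it into the gradient bound.\<close>
  have *: "m * g n \<le> k n n * (Y - y n) \<and> y n \<le> Y" if "1 \<le> n" "n \<le> N" for n
    using that
  proof (induction n rule: less_induct)
    case (less n)
    have e: "0 \<le> Y - y j" if "j < n" for j
    proof (cases "j = 0")
      case True
      then show ?thesis using A'0 Gamma_pos \<alpha> by (simp add: Y)
    qed (use less that in auto)
    have "k n 1 * (Y - y 0) - k n n * (Y - y n) \<le> (\<Sum>j=1..n. k n j * ((Y - y (j - 1)) - (Y - y j)))"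
      using less e by (intro weighted_telescope_ge L1_weight_mono) auto
    also have "\<dots> \<le> A' - m * g n"
      using main[of n] less by simp
    finally have 1: "k n 1 * (Y - y 0) - A' + m * g n \<le> k n n * (Y - y n)" by simp
    \<comment> \<open>\<open>Y\<close> was defined to make this an identity.\<close>
    have "A' = (1 - \<alpha>) * T powr (- \<alpha>) / Gamma (2 - \<alpha>) * (Y - y 0)"
    proof -
      have "Gamma (2 - \<alpha>) \<noteq> 0" "T powr \<alpha> \<noteq> 0" "1 - \<alpha> \<noteq> 0"
        using \<alpha> T less_imp_neq[OF Gamma_pos] by auto
      then show ?thesis by (simp add: Y powr_minus_divide)
    qed
    also have "\<dots> \<le> k n 1 * (Y - y 0)"
      using less e[of 0] by (intro mult_right_mono L1_weight_first_ge) auto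
    finally have 2: "m * g n \<le> k n n * (Y - y n)" using 1 by simp
    moreover have "0 < k n n"
      using less Gamma_pos \<tau>_pos[of n] by (simp add: L1_weight_diag)
    ultimately have "0 \<le> Y - y n"
      using m g[of n] by (smt (verit) mult_pos_neg mult_nonneg_nonneg)
    with 2 show ?case by simp
  qed
  from *[OF n] show "y n \<le> Y" by simp
  from *[OF n] have "m * g n \<le> k n n * (Y - y n)" by simp
  also have "\<dots> \<le> k n n * Y"
    using y[of n] L1_weight_nonneg[of n n] n by (intro mult_left_mono) auto
  also have "\<dots> = \<tau> n powr (- \<alpha>) / Gamma (2 - \<alpha>) * Y"
    using n by (simp add: L1_weight_diag)
  finally have "\<tau> n powr \<alpha> * (m * g n) \<le> \<tau> n powr \<alpha> * (\<tau> n powr (- \<alpha>) / Gamma (2 - \<alpha>) * Y)"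
    by (intro mult_left_mono) auto
  also have "\<dots> = Y / Gamma (2 - \<alpha>)"
    using \<tau>_pos[OF n(1)] by (simp add: powr_minus_divide)
  finally show "\<tau> n powr \<alpha> * g n \<le> Y / (m * Gamma (2 - \<alpha>))"
    using m Gamma_pos by (simp add: field_simps)
qed

end

section \<open>Square integrable functions and the Poincare inequality\<close>

text \<open>Vector values are allowed so that functions and their gradients share the same
  estimates.\<close>

definition square_integrable :: "(real^'d) set \<Rightarrow> (real^'d \<Rightarrow> 'b::euclidean_space) \<Rightarrow> bool" where
  "square_integrable \<Omega> u \<longleftrightarrow> u \<in> borel_measurable (lebesgue_on \<Omega>) \<and>
     integrable (lebesgue_on \<Omega>) (\<lambda>x. (norm (u x))\<^sup>2)"

lemma L2_space_iff: "u \<in> L2_space \<Omega> \<longleftrightarrow> square_integrable \<Omega> u"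
  by (simp add: L2_space_def square_integrable_def)

lemma L2_inner_self_nonneg: "0 \<le> L2_inner \<Omega> u u"
  unfolding L2_inner_def by (intro integral_nonneg_AE) auto

lemma L2_norm_nonneg: "0 \<le> L2_norm \<Omega> u"
  by (simp add: L2_norm_def L2_inner_self_nonneg)

lemma L2_norm_sq: "(L2_norm \<Omega> u)\<^sup>2 = L2_inner \<Omega> u u"
  by (simp add: L2_norm_def L2_inner_self_nonneg)

lemma square_integrable_mult_norm:
  assumes "square_integrable \<Omega> u" "square_integrable \<Omega> v"
  shows "integrable (lebesgue_on \<Omega>) (\<lambda>x. norm (u x) * norm (v x))"
proof (rule Bochner_Integration.integrable_bound)
  show "integrable (lebesgue_on \<Omega>) (\<lambda>x. (norm (u x))\<^sup>2 + (norm (v x))\<^sup>2)"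
    using assms by (auto simp: square_integrable_def)
  have [measurable]: "u \<in> borel_measurable (lebesgue_on \<Omega>)" "v \<in> borel_measurable (lebesgue_on \<Omega>)"
    using assms by (auto simp: square_integrable_def)
  show "(\<lambda>x. norm (u x) * norm (v x)) \<in> borel_measurable (lebesgue_on \<Omega>)" by measurable
  have "norm (u x) * norm (v x) \<le> (norm (u x))\<^sup>2 + (norm (v x))\<^sup>2" for x
    using sum_squares_bound[of "norm (u x)" "norm (v x)"] mult_nonneg_nonneg[OF norm_ge_zero[of "u x"] norm_ge_zero[of "v x"]]
    by linarith
  then show "AE x in lebesgue_on \<Omega>. norm (norm (u x) * norm (v x)) \<le> norm ((norm (u x))\<^sup>2 + (norm (v x))\<^sup>2)"
    by simp
qed

lemma square_integrable_inner:
  assumes "square_integrable \<Omega> u" "square_integrable \<Omega> v"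
  shows "integrable (lebesgue_on \<Omega>) (\<lambda>x. u x \<bullet> v x)"
proof (rule Bochner_Integration.integrable_bound[OF square_integrable_mult_norm[OF assms]])
  have [measurable]: "u \<in> borel_measurable (lebesgue_on \<Omega>)" "v \<in> borel_measurable (lebesgue_on \<Omega>)"
    using assms by (auto simp: square_integrable_def)
  show "(\<lambda>x. u x \<bullet> v x) \<in> borel_measurable (lebesgue_on \<Omega>)" by measurable
qed (auto intro!: AE_I2 simp: Cauchy_Schwarz_ineq2)

lemma square_integrable_add:
  assumes "square_integrable \<Omega> u" "square_integrable \<Omega> v"
  shows "square_integrable \<Omega> (\<lambda>x. u x + v x)"
proof -
  have [measurable]: "u \<in> borel_measurable (lebesgue_on \<Omega>)" "v \<in> borel_measurable (lebesgue_on \<Omega>)"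
    using assms by (auto simp: square_integrable_def)
  have "integrable (lebesgue_on \<Omega>) (\<lambda>x. (norm (u x))\<^sup>2 + (norm (v x))\<^sup>2 + 2 * (u x \<bullet> v x))"
    using assms square_integrable_inner[OF assms] by (auto simp: square_integrable_def)
  moreover have "(norm (u x))\<^sup>2 + (norm (v x))\<^sup>2 + 2 * (u x \<bullet> v x) = (norm (u x + v x))\<^sup>2" for x
    by (simp add: power2_norm_eq_inner inner_add_left inner_add_right inner_commute)
  ultimately show ?thesis by (simp add: square_integrable_def)
qed

lemma square_integrable_uminus: "square_integrable \<Omega> u \<Longrightarrow> square_integrable \<Omega> (\<lambda>x. - u x)"
  by (simp add: square_integrable_def)

lemma square_integrable_diff:
  assumes "square_integrable \<Omega> u" "square_integrable \<Omega> v"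
  shows "square_integrable \<Omega> (\<lambda>x. u x - v x)"
  using square_integrable_add[OF assms(1) square_integrable_uminus[OF assms(2)]] by simp

lemma square_integrable_mult_bounded:
  fixes u h :: "real^'d \<Rightarrow> real"
  assumes u: "square_integrable \<Omega> u" and h: "h \<in> borel_measurable (lebesgue_on \<Omega>)"
    and R: "\<And>x. x \<in> \<Omega> \<Longrightarrow> \<bar>h x\<bar> \<le> R"
  shows "square_integrable \<Omega> (\<lambda>x. h x * u x)"
  unfolding square_integrable_def
proof
  have [measurable]: "u \<in> borel_measurable (lebesgue_on \<Omega>)"
    using assms by (auto simp: square_integrable_def)
  note h[measurable]
  show "(\<lambda>x. h x * u x) \<in> borel_measurable (lebesgue_on \<Omega>)" by measurable
  show "integrable (lebesgue_on \<Omega>) (\<lambda>x. (norm (h x * u x))\<^sup>2)"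
  proof (rule Bochner_Integration.integrable_bound)
    show "integrable (lebesgue_on \<Omega>) (\<lambda>x. R\<^sup>2 * (norm (u x))\<^sup>2)"
      using u by (auto simp: square_integrable_def)
    have "(h x * u x)\<^sup>2 \<le> R\<^sup>2 * (u x)\<^sup>2" if "x \<in> \<Omega>" for x
      using R[OF that] unfolding power_mult_distrib by (intro mult_right_mono abs_le_square_iff[THEN iffD1]) auto
    then show "AE x in lebesgue_on \<Omega>. norm ((norm (h x * u x))\<^sup>2) \<le> norm (R\<^sup>2 * (norm (u x))\<^sup>2)"
      by (intro AE_I2) (auto simp: space_restrict_space)
  qed measurable
qed

lemma quadratic_nonneg_imp_discriminant:
  fixes A B I :: real
  assumes *: "\<And>r. 0 \<le> A - 2 * r * I + r\<^sup>2 * B" and B0: "0 \<le> B"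
  shows "I\<^sup>2 \<le> A * B"
proof (cases "B = 0")
  case True
  have "I = 0"
  proof (rule ccontr)
    assume "I \<noteq> 0"
    \<comment> \<open>With \<open>B = 0\<close> this \<open>r\<close> gives the quadratic the value
      -1.\<close>
    then show False using *[of "(A + 1) / (2 * I)"] True by simp
  qed
  then show ?thesis using True by simp
next
  case False
  then have B: "0 < B" using B0 by simp
  have "0 \<le> A - I\<^sup>2 / B"
    using *[of "I / B"] B by (simp add: power2_eq_square)
  then show ?thesis using B by (simp add: field_simps)
qed

lemma L2_inner_add_right:
  assumes "square_integrable \<Omega> u" "square_integrable \<Omega> v" "square_integrable \<Omega> w"
  shows "L2_inner \<Omega> u (\<lambda>x. v x + w x) = L2_inner \<Omega> u v + L2_inner \<Omega> u w"
  using assms by (simp add: L2_inner_def inner_add_right square_integrable_inner)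

lemma L2_inner_diff_right:
  assumes "square_integrable \<Omega> u" "square_integrable \<Omega> v" "square_integrable \<Omega> w"
  shows "L2_inner \<Omega> u (\<lambda>x. v x - w x) = L2_inner \<Omega> u v - L2_inner \<Omega> u w"
  using assms by (simp add: L2_inner_def inner_diff_right square_integrable_inner)

text \<open>Cauchy-Schwarz for pointwise norms instead of inner products, so that it also covers
  pairings that are merely dominated pointwise, such as those with coefficients.\<close>

lemma integral_mult_norm_le:
  assumes u: "square_integrable \<Omega> u" and v: "square_integrable \<Omega> v"
  shows "(LINT x|lebesgue_on \<Omega>. norm (u x) * norm (v x)) \<le> L2_norm \<Omega> u * L2_norm \<Omega> v"
proof -
  let ?I = "LINT x|lebesgue_on \<Omega>. norm (u x) * norm (v x)"
  have "0 \<le> (L2_norm \<Omega> u)\<^sup>2 - 2 * r * ?I + r\<^sup>2 * (L2_norm \<Omega> v)\<^sup>2" for r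
  proof -
    have "0 \<le> (LINT x|lebesgue_on \<Omega>. (norm (u x))\<^sup>2 - 2 * r * (norm (u x) * norm (v x)) + r\<^sup>2 * (norm (v x))\<^sup>2)"
    proof (rule integral_nonneg_AE, rule AE_I2)
      fix x
      have "0 \<le> (norm (u x) - r * norm (v x))\<^sup>2" by simp
      then show "0 \<le> (norm (u x))\<^sup>2 - 2 * r * (norm (u x) * norm (v x)) + r\<^sup>2 * (norm (v x))\<^sup>2"
        by (simp add: power2_eq_square algebra_simps)
    qed
    also have "\<dots> = (LINT x|lebesgue_on \<Omega>. (norm (u x))\<^sup>2) - 2 * r * ?I + r\<^sup>2 * (LINT x|lebesgue_on \<Omega>. (norm (v x))\<^sup>2)"
      using u v square_integrable_mult_norm[OF u v] by (simp add: square_integrable_def)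
    finally show ?thesis by (simp add: L2_norm_sq L2_inner_def power2_norm_eq_inner)
  qed
  then have "?I\<^sup>2 \<le> (L2_norm \<Omega> u)\<^sup>2 * (L2_norm \<Omega> v)\<^sup>2"
    by (rule quadratic_nonneg_imp_discriminant) simp
  then show ?thesis
    unfolding power_mult_distrib[symmetric] by (rule power2_le_imp_le) (simp add: L2_norm_nonneg)
qed

text \<open>No integrability of \<open>u \<bullet> v\<close> is needed: otherwise the Bochner integral is \<open>0\<close>.\<close>

lemma abs_L2_inner_le:
  assumes w: "square_integrable \<Omega> w" and z: "square_integrable \<Omega> z" and c: "0 \<le> c"
    and le: "\<And>x. x \<in> \<Omega> \<Longrightarrow> \<bar>u x \<bullet> v x\<bar> \<le> c * (norm (w x) * norm (z x))"
  shows "\<bar>L2_inner \<Omega> u v\<bar> \<le> c * (L2_norm \<Omega> w * L2_norm \<Omega> z)"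
proof (cases "integrable (lebesgue_on \<Omega>) (\<lambda>x. u x \<bullet> v x)")
  case True
  have "\<bar>L2_inner \<Omega> u v\<bar> \<le> (LINT x|lebesgue_on \<Omega>. c * (norm (w x) * norm (z x)))"
    unfolding L2_inner_def real_norm_def[symmetric]
    using True square_integrable_mult_norm[OF w z] le
    by (intro Bochner_Integration.integral_norm_bound_integral) (auto simp: space_restrict_space)
  also have "\<dots> = c * (LINT x|lebesgue_on \<Omega>. norm (w x) * norm (z x))" by simp
  also have "\<dots> \<le> c * (L2_norm \<Omega> w * L2_norm \<Omega> z)"
    by (intro mult_left_mono integral_mult_norm_le w z c)
  finally show ?thesis .
next
  case False
  then show ?thesis
    using c by (simp add: L2_inner_def not_integrable_integral_eq L2_norm_nonneg)
qed

lemma L2_Cauchy_Schwarz: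
  assumes "square_integrable \<Omega> u" "square_integrable \<Omega> v"
  shows "\<bar>L2_inner \<Omega> u v\<bar> \<le> L2_norm \<Omega> u * L2_norm \<Omega> v"
  using abs_L2_inner_le[of \<Omega> u v 1 u v] assms by (simp add: Cauchy_Schwarz_ineq2)

lemma continuous_square_integrable:
  fixes h :: "real^'d \<Rightarrow> real"
  assumes \<Omega>: "open \<Omega>" "bounded \<Omega>" and h: "continuous_on UNIV h"
  shows "square_integrable \<Omega> h"
proof -
  have h\<Omega>: "h \<in> borel_measurable (lebesgue_on \<Omega>)"
    using \<Omega> continuous_on_subset[OF h] by (intro continuous_imp_measurable_on_sets_lebesgue) auto
  have fin: "finite_measure (lebesgue_on \<Omega>)"
    using \<Omega> by (intro finite_measure_lebesgue_on lmeasurable_open)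
  have "compact (closure \<Omega>)" using \<Omega> by simp
  then have "compact (h ` closure \<Omega>)"
    using continuous_on_subset[OF h] by (intro compact_continuous_image) auto
  then obtain R where R: "\<And>x. x \<in> closure \<Omega> \<Longrightarrow> \<bar>h x\<bar> \<le> R"
    using compact_imp_bounded by (force simp: bounded_iff)
  have "square_integrable \<Omega> (\<lambda>x. 1::real)"
    using fin by (simp add: square_integrable_def finite_measure.integrable_const)
  from square_integrable_mult_bounded[OF this h\<Omega>, of R] show ?thesis
    using R closure_subset by auto
qed

section \<open>Test functions multiplied by a linear function\<close>

lemma Ck_on_SucD: "Ck_on (Suc k) f S \<Longrightarrow> Ck_on k f S"
  by (induction k arbitrary: f) (auto intro: differentiable_imp_continuous_on)

lemma frechet_derivative_add:
  assumes "f differentiable (at x)" "g differentiable (at x)"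
  shows "frechet_derivative (\<lambda>x. f x + g x) (at x) b
    = frechet_derivative f (at x) b + frechet_derivative g (at x) b"
  using fun_cong[OF frechet_derivative_at[OF has_derivative_add[OF
    assms[unfolded frechet_derivative_works]]], of b] by simp

lemma frechet_derivative_cmult:
  fixes f :: "'a::real_normed_vector \<Rightarrow> real"
  assumes "f differentiable (at x)"
  shows "frechet_derivative (\<lambda>x. c * f x) (at x) b = c * frechet_derivative f (at x) b"
  using fun_cong[OF frechet_derivative_at[OF has_derivative_mult_right[OF
    assms[unfolded frechet_derivative_works]]], of c b] by simp

lemma frechet_derivative_inner_mult:
  fixes f :: "'a::euclidean_space \<Rightarrow> real"
  assumes "f differentiable (at x)"
  shows "frechet_derivative (\<lambda>x. (x \<bullet> a) * f x) (at x) b = (b \<bullet> a) * f x + (x \<bullet> a) * frechet_derivative f (at x) b"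
  using fun_cong[OF frechet_derivative_at[OF has_derivative_mult[OF
    has_derivative_inner_left[OF has_derivative_ident] assms[unfolded frechet_derivative_works]]], of a b] by simp

lemma Ck_on_add: "Ck_on k f UNIV \<Longrightarrow> Ck_on k g UNIV \<Longrightarrow> Ck_on k (\<lambda>x. f x + g x) UNIV"
proof (induction k arbitrary: f g)
  case (Suc k)
  then have "f differentiable (at x)" "g differentiable (at x)" for x
    by (auto simp: differentiable_on_def)
  then have "(\<lambda>x. frechet_derivative (\<lambda>x. f x + g x) (at x) b)
      = (\<lambda>x. frechet_derivative f (at x) b + frechet_derivative g (at x) b)" for b
    by (simp add: frechet_derivative_add)
  with Suc show ?case by simp
qed (auto intro!: continuous_intros)

lemma Ck_on_cmult: "Ck_on k f UNIV \<Longrightarrow> Ck_on k (\<lambda>x. c * f x) UNIV"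
proof (induction k arbitrary: f)
  case (Suc k)
  then have "f differentiable (at x)" for x by (auto simp: differentiable_on_def)
  then have "(\<lambda>x. frechet_derivative (\<lambda>x. c * f x) (at x) b)
      = (\<lambda>x. c * frechet_derivative f (at x) b)" for b
    by (simp add: frechet_derivative_cmult)
  with Suc show ?case by simp
qed (auto intro!: continuous_intros)

text \<open>With a linear factor the induction closes without a general product rule:
  differentiation gives a multiple of \<open>f\<close> plus a product of the same form with a
  derivative of \<open>f\<close>.\<close>

lemma Ck_on_inner_mult: "Ck_on k f UNIV \<Longrightarrow> Ck_on k (\<lambda>x. (x \<bullet> a) * f x) UNIV"
proof (induction k arbitrary: f)
  case (Suc k)
  then have d: "f differentiable (at x)" for x by (simp add: differentiable_on_def)
  then have eq: "(\<lambda>x. frechet_derivative (\<lambda>x. (x \<bullet> a) * f x) (at x) b)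
      = (\<lambda>x. (b \<bullet> a) * f x + (x \<bullet> a) * frechet_derivative f (at x) b)" for b
    by (simp add: frechet_derivative_inner_mult)
  have "Ck_on k f UNIV" using Suc.prems by (rule Ck_on_SucD)
  moreover have "Ck_on k (\<lambda>x. (x \<bullet> a) * frechet_derivative f (at x) b) UNIV" if "b \<in> Basis" for b
    using Suc.prems that by (intro Suc.IH) simp
  moreover have "(\<lambda>x. (x \<bullet> a) * f x) differentiable (at x)" for x
    using d by (intro differentiable_mult differentiable_inner differentiable_ident differentiable_const)
  ultimately show ?case
    unfolding Ck_on.simps eq by (auto simp: differentiable_on_def intro: Ck_on_add Ck_on_cmult)
qed (auto intro!: continuous_intros)

lemma test_function_inner_mult:
  assumes "test_function \<Omega> \<phi>"
  shows "test_function \<Omega> (\<lambda>x. (x \<bullet> a) * \<phi> x)"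
proof -
  have sub: "closure {x. (x \<bullet> a) * \<phi> x \<noteq> 0} \<subseteq> closure {x. \<phi> x \<noteq> 0}"
    by (intro closure_mono) auto
  have "compact (closure {x. \<phi> x \<noteq> 0} \<inter> closure {x. (x \<bullet> a) * \<phi> x \<noteq> 0})"
    using assms by (intro compact_Int_closed closed_closure) (simp add: test_function_def)
  then have "compact (closure {x. (x \<bullet> a) * \<phi> x \<noteq> 0})"
    using sub by (simp only: Int_absorb1)
  with sub show ?thesis
    using assms unfolding test_function_def smooth_on_def by (blast intro: Ck_on_inner_mult)
qed

section \<open>Weak gradients and the Poincare inequality\<close>

lemma wgrad_has_weak_pderiv:
  assumes "u \<in> sobolev 1 \<Omega>"
  shows "has_weak_pderiv \<Omega> i u (\<lambda>x. wgrad \<Omega> u x $ i)"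
proof -
  have "\<exists>g. has_weak_pderiv \<Omega> i u g" using assms by auto
  then have "has_weak_pderiv \<Omega> i u (SOME g. has_weak_pderiv \<Omega> i u g)" by (rule someI_ex)
  then show ?thesis by (simp add: wgrad_def)
qed

lemma square_integrable_vec:
  fixes G :: "real^'d \<Rightarrow> real^'d"
  assumes "\<And>i. square_integrable \<Omega> (\<lambda>x. G x $ i)"
  shows "square_integrable \<Omega> G"
proof -
  have "G \<in> borel_measurable (lebesgue_on \<Omega>)"
    using assms by (subst borel_measurable_euclidean_space)
      (auto simp: square_integrable_def Basis_vec_def inner_axis)
  moreover have "integrable (lebesgue_on \<Omega>) (\<lambda>x. \<Sum>i\<in>UNIV. (G x $ i)\<^sup>2)"
    using assms by (intro Bochner_Integration.integrable_sum) (auto simp: square_integrable_def)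
  moreover have "(\<Sum>i\<in>UNIV. (G x $ i)\<^sup>2) = (norm (G x))\<^sup>2" for x
    unfolding power2_norm_eq_inner inner_vec_def by (simp add: power2_eq_square)
  ultimately show ?thesis by (simp add: square_integrable_def)
qed

lemma square_integrable_wgrad:
  assumes "u \<in> sobolev 1 \<Omega>" shows "square_integrable \<Omega> (wgrad \<Omega> u)"
  using wgrad_has_weak_pderiv[OF assms]
  by (intro square_integrable_vec) (auto simp: has_weak_pderiv_def L2_space_iff)

lemma H10_sobolev: "u \<in> H10_space \<Omega> \<Longrightarrow> u \<in> sobolev 1 \<Omega>"
  by (simp add: H10_space_def)

lemma square_integrable_H10: "u \<in> H10_space \<Omega> \<Longrightarrow> square_integrable \<Omega> u"
  by (simp add: H10_space_def L2_space_iff)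

text \<open>The weak derivative of \<open>u\<close> is tested with \<open>x\<^sub>i \<phi>\<close>, so that no integration by parts for
  \<open>\<phi>\<close> is needed; for \<open>\<phi> \<rightarrow> u\<close> this gives the Poincare inequality.\<close>

lemma L2_norm_sq_le_test_function:
  fixes \<Omega> :: "(real^'d) set"
  assumes \<Omega>: "open \<Omega>" "bounded \<Omega>" and R: "\<And>x. x \<in> \<Omega> \<Longrightarrow> norm x \<le> R" "0 \<le> R"
    and u: "u \<in> sobolev 1 \<Omega>" and \<phi>: "test_function \<Omega> \<phi>"
  shows "(L2_norm \<Omega> u)\<^sup>2 \<le> 2 * R * (L2_norm \<Omega> u * L2_norm \<Omega> (wgrad \<Omega> u))
    + (L2_norm \<Omega> u + R * L2_norm \<Omega> (wgrad \<Omega> u)) * L2_norm \<Omega> (\<lambda>x. u x - \<phi> x)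
    + R * L2_norm \<Omega> u * L2_norm \<Omega> (\<lambda>x. wgrad \<Omega> u x - grad \<phi> x)"
proof -
  \<comment> \<open>A single coordinate direction, arbitrarily chosen, is enough.\<close>
  fix i :: 'd
  define g where "g x = wgrad \<Omega> u x $ i" for x
  define d where "d x = grad \<phi> x $ i" for x
  define X where "X x = x \<bullet> axis i 1" for x :: "real^'d"
  have X: "\<bar>X x\<bar> \<le> R" if "x \<in> \<Omega>" for x
    using R(1)[OF that] component_le_norm_cart[of x i] by (simp add: X_def inner_axis)
  have Xm: "X \<in> borel_measurable (lebesgue_on \<Omega>)"
    unfolding X_def using \<Omega>
    by (intro continuous_imp_measurable_on_sets_lebesgue) (auto intro!: continuous_intros)
  have W: "has_weak_pderiv \<Omega> i u g" unfolding g_def by (rule wgrad_has_weak_pderiv[OF u])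
  have su: "square_integrable \<Omega> u" and sg: "square_integrable \<Omega> g" and sG: "square_integrable \<Omega> (wgrad \<Omega> u)"
    using W square_integrable_wgrad[OF u] by (auto simp: has_weak_pderiv_def L2_space_iff)
  have C: "Ck_on k \<phi> UNIV" for k using \<phi> by (simp add: test_function_def smooth_on_def)
  have c\<phi>: "continuous_on UNIV \<phi>" using C[of 0] by simp
  have diff: "\<phi> differentiable (at x)" for x using C[of 1] by (simp add: differentiable_on_def)
  have cd: "continuous_on UNIV (\<lambda>x. grad \<phi> x $ j)" for j
    using C[of 1] by (simp add: grad_def axis_in_Basis_iff)
  have s\<phi>: "square_integrable \<Omega> \<phi>" and sd: "square_integrable \<Omega> d" and sD: "square_integrable \<Omega> (grad \<phi>)"
    using continuous_square_integrable[OF \<Omega> c\<phi>] continuous_square_integrable[OF \<Omega> cd]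
    by (auto simp: d_def[abs_def] intro: square_integrable_vec)
  have sX: "square_integrable \<Omega> (\<lambda>x. X x * h x)" if "square_integrable \<Omega> h" for h
    using that Xm X by (rule square_integrable_mult_bounded)
  note s = su sg s\<phi> sd sX square_integrable_diff square_integrable_add
  \<comment> \<open>The derivative of \<open>x\<^sub>i \<phi>\<close> in direction \<open>i\<close>
    contains \<open>\<phi>\<close> itself; the pairing of \<open>u\<close> with that term is what
    becomes the squared norm of \<open>u\<close>.\<close>
  have "L2_inner \<Omega> u (\<lambda>x. grad (\<lambda>x. (x \<bullet> axis i 1) * \<phi> x) x $ i) = - L2_inner \<Omega> g (\<lambda>x. (x \<bullet> axis i 1) * \<phi> x)"
    using W test_function_inner_mult[OF \<phi>, of "axis i 1"] by (simp add: has_weak_pderiv_def)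
  also have "(\<lambda>x. grad (\<lambda>x. (x \<bullet> axis i 1) * \<phi> x) x $ i) = (\<lambda>x. \<phi> x + X x * d x)"
    by (simp add: grad_def d_def X_def frechet_derivative_inner_mult[OF diff] inner_axis_axis)
  finally have 1: "L2_inner \<Omega> u \<phi> + L2_inner \<Omega> u (\<lambda>x. X x * d x) = - L2_inner \<Omega> g (\<lambda>x. X x * \<phi> x)"
    using s by (simp add: L2_inner_add_right X_def)
  have 2: "L2_inner \<Omega> u (\<lambda>x. u x - \<phi> x) = L2_inner \<Omega> u u - L2_inner \<Omega> u \<phi>"
    using s by (simp add: L2_inner_diff_right)
  have 3: "L2_inner \<Omega> u (\<lambda>x. X x * (g x - d x)) = L2_inner \<Omega> u (\<lambda>x. X x * g x) - L2_inner \<Omega> u (\<lambda>x. X x * d x)"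
    using s by (simp add: L2_inner_diff_right right_diff_distrib)
  have 4: "L2_inner \<Omega> g (\<lambda>x. X x * (u x - \<phi> x)) = L2_inner \<Omega> g (\<lambda>x. X x * u x) - L2_inner \<Omega> g (\<lambda>x. X x * \<phi> x)"
    using s by (simp add: L2_inner_diff_right right_diff_distrib)
  have g: "\<bar>g x\<bar> \<le> norm (wgrad \<Omega> u x)" "\<bar>g x - d x\<bar> \<le> norm (wgrad \<Omega> u x - grad \<phi> x)" for x
    using component_le_norm_cart[of "wgrad \<Omega> u x" i] component_le_norm_cart[of "wgrad \<Omega> u x - grad \<phi> x" i]
    by (auto simp: g_def d_def)
  have b2: "\<bar>L2_inner \<Omega> u (\<lambda>x. u x - \<phi> x)\<bar> \<le> L2_norm \<Omega> u * L2_norm \<Omega> (\<lambda>x. u x - \<phi> x)"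
    using s by (intro L2_Cauchy_Schwarz)
  have b3: "\<bar>L2_inner \<Omega> u (\<lambda>x. X x * g x)\<bar> \<le> R * (L2_norm \<Omega> u * L2_norm \<Omega> (wgrad \<Omega> u))"
  proof (rule abs_L2_inner_le[OF su sG R(2)])
    fix x assume "x \<in> \<Omega>"
    then have "\<bar>X x\<bar> * (\<bar>u x\<bar> * \<bar>g x\<bar>) \<le> R * (norm (u x) * norm (wgrad \<Omega> u x))"
      using X R g by (intro mult_mono) auto
    then show "\<bar>u x \<bullet> (X x * g x)\<bar> \<le> R * (norm (u x) * norm (wgrad \<Omega> u x))"
      by (simp add: abs_mult mult_ac)
  qed
  have b4: "\<bar>L2_inner \<Omega> u (\<lambda>x. X x * (g x - d x))\<bar> \<le> R * (L2_norm \<Omega> u * L2_norm \<Omega> (\<lambda>x. wgrad \<Omega> u x - grad \<phi> x))"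
  proof (rule abs_L2_inner_le[OF su square_integrable_diff[OF sG sD] R(2)])
    fix x assume "x \<in> \<Omega>"
    then have "\<bar>X x\<bar> * (\<bar>u x\<bar> * \<bar>g x - d x\<bar>) \<le> R * (norm (u x) * norm (wgrad \<Omega> u x - grad \<phi> x))"
      using X R g by (intro mult_mono) auto
    then show "\<bar>u x \<bullet> (X x * (g x - d x))\<bar> \<le> R * (norm (u x) * norm (wgrad \<Omega> u x - grad \<phi> x))"
      by (simp add: abs_mult mult_ac)
  qed
  have b5: "\<bar>L2_inner \<Omega> g (\<lambda>x. X x * u x)\<bar> \<le> R * (L2_norm \<Omega> u * L2_norm \<Omega> (wgrad \<Omega> u))"
  proof (rule abs_L2_inner_le[OF su sG R(2)])
    fix x assume "x \<in> \<Omega>"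
    then have "\<bar>X x\<bar> * (\<bar>u x\<bar> * \<bar>g x\<bar>) \<le> R * (norm (u x) * norm (wgrad \<Omega> u x))"
      using X R g by (intro mult_mono) auto
    then show "\<bar>g x \<bullet> (X x * u x)\<bar> \<le> R * (norm (u x) * norm (wgrad \<Omega> u x))"
      by (simp add: abs_mult mult_ac)
  qed
  have b6: "\<bar>L2_inner \<Omega> g (\<lambda>x. X x * (u x - \<phi> x))\<bar> \<le> R * (L2_norm \<Omega> (wgrad \<Omega> u) * L2_norm \<Omega> (\<lambda>x. u x - \<phi> x))"
  proof (rule abs_L2_inner_le[OF sG square_integrable_diff[OF su s\<phi>] R(2)])
    fix x assume "x \<in> \<Omega>"
    then have "\<bar>X x\<bar> * (\<bar>g x\<bar> * \<bar>u x - \<phi> x\<bar>) \<le> R * (norm (wgrad \<Omega> u x) * norm (u x - \<phi> x))"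
      using X R g by (intro mult_mono) auto
    then show "\<bar>g x \<bullet> (X x * (u x - \<phi> x))\<bar> \<le> R * (norm (wgrad \<Omega> u x) * norm (u x - \<phi> x))"
      by (simp add: abs_mult mult_ac)
  qed
  \<comment> \<open>Every occurrence of \<open>\<phi>\<close> is traded for \<open>u\<close> plus an
    error. Besides the errors, two terms remain, one with \<open>u\<close> and one with
    \<open>g\<close> in front; together they give \<open>2 * R\<close>.\<close>
  have "L2_inner \<Omega> u u = L2_inner \<Omega> u (\<lambda>x. u x - \<phi> x) - L2_inner \<Omega> g (\<lambda>x. X x * u x)
      + L2_inner \<Omega> g (\<lambda>x. X x * (u x - \<phi> x)) - L2_inner \<Omega> u (\<lambda>x. X x * g x)
      + L2_inner \<Omega> u (\<lambda>x. X x * (g x - d x))"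
    using 1 2 3 4 by simp
  also have "\<dots> \<le> L2_norm \<Omega> u * L2_norm \<Omega> (\<lambda>x. u x - \<phi> x)
      + R * (L2_norm \<Omega> u * L2_norm \<Omega> (wgrad \<Omega> u))
      + R * (L2_norm \<Omega> (wgrad \<Omega> u) * L2_norm \<Omega> (\<lambda>x. u x - \<phi> x))
      + R * (L2_norm \<Omega> u * L2_norm \<Omega> (wgrad \<Omega> u))
      + R * (L2_norm \<Omega> u * L2_norm \<Omega> (\<lambda>x. wgrad \<Omega> u x - grad \<phi> x))"
    using b2 b3 b4 b5 b6 by linarith
  finally show ?thesis by (simp add: L2_norm_sq algebra_simps)
qed

lemma Poincare_inequality:
  fixes \<Omega> :: "(real^'d) set"
  assumes \<Omega>: "open \<Omega>" "bounded \<Omega>" and R: "\<And>x. x \<in> \<Omega> \<Longrightarrow> norm x \<le> R" "0 \<le> R"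
    and u: "u \<in> H10_space \<Omega>"
  shows "L2_norm \<Omega> u \<le> 2 * R * L2_norm \<Omega> (wgrad \<Omega> u)"
proof -
  obtain \<phi> where \<phi>: "\<And>k. test_function \<Omega> (\<phi> k)"
    and l1: "(\<lambda>k. L2_norm \<Omega> (\<lambda>x. u x - \<phi> k x)) \<longlonglongrightarrow> 0"
    and l2: "(\<lambda>k. L2_norm \<Omega> (\<lambda>x. wgrad \<Omega> u x - grad (\<phi> k) x)) \<longlonglongrightarrow> 0"
    using u by (auto simp: H10_space_def)
  have lim: "(\<lambda>k. 2 * R * (L2_norm \<Omega> u * L2_norm \<Omega> (wgrad \<Omega> u))
    + (L2_norm \<Omega> u + R * L2_norm \<Omega> (wgrad \<Omega> u)) * L2_norm \<Omega> (\<lambda>x. u x - \<phi> k x)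
    + R * L2_norm \<Omega> u * L2_norm \<Omega> (\<lambda>x. wgrad \<Omega> u x - grad (\<phi> k) x))
    \<longlonglongrightarrow> 2 * R * (L2_norm \<Omega> u * L2_norm \<Omega> (wgrad \<Omega> u))
    + (L2_norm \<Omega> u + R * L2_norm \<Omega> (wgrad \<Omega> u)) * 0 + R * L2_norm \<Omega> u * 0"
    by (intro tendsto_intros l1 l2)
  have "(L2_norm \<Omega> u)\<^sup>2 \<le> 2 * R * (L2_norm \<Omega> u * L2_norm \<Omega> (wgrad \<Omega> u))
    + (L2_norm \<Omega> u + R * L2_norm \<Omega> (wgrad \<Omega> u)) * 0 + R * L2_norm \<Omega> u * 0"
    by (rule tendsto_lowerbound[OF lim])
      (auto intro!: always_eventually L2_norm_sq_le_test_function[OF \<Omega> R H10_sobolev[OF u] \<phi>])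
  then have "L2_norm \<Omega> u * L2_norm \<Omega> u \<le> L2_norm \<Omega> u * (2 * R * L2_norm \<Omega> (wgrad \<Omega> u))"
    by (simp add: power2_eq_square mult_ac)
  then show ?thesis
    using L2_norm_nonneg[of \<Omega> u] L2_norm_nonneg[of \<Omega> "wgrad \<Omega> u"] R(2)
    by (cases "L2_norm \<Omega> u = 0") auto
qed

section \<open>Boundedness of the memory form\<close>

lemma smooth_coefficient_bounded:
  assumes "bounded \<Omega>" "smooth_coefficient \<Omega> T b"
  obtains c where "0 \<le> c" "\<And>x t s. x \<in> \<Omega> \<Longrightarrow> t \<in> {0..T} \<Longrightarrow> s \<in> {0..T} \<Longrightarrow> \<bar>b x t s\<bar> \<le> c"
proof -
  let ?S = "closure \<Omega> \<times> {0..T} \<times> {0..T}"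
  obtain U g where U: "?S \<subseteq> U" "smooth_on U g" "\<forall>z\<in>?S. g z = (\<lambda>(x, t, s). b x t s) z"
    using assms(2) unfolding smooth_coefficient_def smooth_on_closed_def by blast
  have "Ck_on 0 g U" using U(2) unfolding smooth_on_def by blast
  then have "continuous_on ?S g" using U(1) continuous_on_subset by auto
  moreover have "compact ?S" using assms(1) by (intro compact_Times) auto
  ultimately have "bounded (g ` ?S)" by (intro compact_imp_bounded compact_continuous_image)
  then obtain c where c: "\<And>z. z \<in> ?S \<Longrightarrow> \<bar>g z\<bar> \<le> c" by (force simp: bounded_iff)
  have "\<bar>b x t s\<bar> \<le> \<bar>c\<bar>" if "x \<in> \<Omega>" "t \<in> {0..T}" "s \<in> {0..T}" for x t s
  proof -
    have z: "(x, t, s) \<in> ?S" using that closure_subset by auto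
    then show ?thesis using c[OF z] bspec[OF U(3) z] by simp
  qed
  then show thesis by (intro that[of "\<bar>c\<bar>"]) auto
qed

lemma norm_vec_le_of_components:
  fixes v :: "real^'d"
  assumes "\<And>i. \<bar>v $ i\<bar> \<le> c"
  shows "norm v \<le> real CARD('d) * c"
proof -
  have "norm v \<le> (\<Sum>i\<in>UNIV. \<bar>v $ i\<bar>)" by (rule norm_le_l1_cart)
  also have "\<dots> \<le> (\<Sum>i\<in>(UNIV::'d set). c)" by (intro sum_mono assms)
  finally show ?thesis by simp
qed

text \<open>The Poincare inequality turns the lower-order terms into gradient norms, so the energy
  argument has only one kind of memory to control. The constant is uniform in both times because the
  coefficients are continuous on a compact set.\<close>

lemma Bform_bounded:
  fixes \<Omega> :: "(real^'d) set" and b2 :: "real^'d \<Rightarrow> real \<Rightarrow> real \<Rightarrow> real^'d^'d"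
  assumes \<Omega>: "open \<Omega>" "bounded \<Omega>"
    and b2: "\<And>i j. smooth_coefficient \<Omega> T (\<lambda>x t s. b2 x t s $ i $ j)"
    and b1: "\<And>i. smooth_coefficient \<Omega> T (\<lambda>x t s. b1 x t s $ i)"
    and b0: "smooth_coefficient \<Omega> T b0"
  obtains c where "0 \<le> c" "\<And>t s w v. t \<in> {0..T} \<Longrightarrow> s \<in> {0..T} \<Longrightarrow> w \<in> H10_space \<Omega> \<Longrightarrow> v \<in> H10_space \<Omega> \<Longrightarrow>
      \<bar>Bform \<Omega> b2 b1 b0 t s w v\<bar> \<le> c * (L2_norm \<Omega> (wgrad \<Omega> w) * L2_norm \<Omega> (wgrad \<Omega> v))"
proof -
  have "\<exists>c. \<forall>x t s. x \<in> \<Omega> \<longrightarrow> t \<in> {0..T} \<longrightarrow> s \<in> {0..T} \<longrightarrow> \<bar>b2 x t s $ i $ j\<bar> \<le> c" for i j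
    using smooth_coefficient_bounded[OF \<Omega>(2) b2[of i j]] by metis
  then obtain C2 where C2: "\<And>i j x t s. x \<in> \<Omega> \<Longrightarrow> t \<in> {0..T} \<Longrightarrow> s \<in> {0..T} \<Longrightarrow> \<bar>b2 x t s $ i $ j\<bar> \<le> C2 i j"
    by metis
  have "\<exists>c. \<forall>x t s. x \<in> \<Omega> \<longrightarrow> t \<in> {0..T} \<longrightarrow> s \<in> {0..T} \<longrightarrow> \<bar>b1 x t s $ i\<bar> \<le> c" for i
    using smooth_coefficient_bounded[OF \<Omega>(2) b1[of i]] by metis
  then obtain C1 where C1: "\<And>i x t s. x \<in> \<Omega> \<Longrightarrow> t \<in> {0..T} \<Longrightarrow> s \<in> {0..T} \<Longrightarrow> \<bar>b1 x t s $ i\<bar> \<le> C1 i"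
    by metis
  obtain c0 where c0: "0 \<le> c0" "\<And>x t s. x \<in> \<Omega> \<Longrightarrow> t \<in> {0..T} \<Longrightarrow> s \<in> {0..T} \<Longrightarrow> \<bar>b0 x t s\<bar> \<le> c0"
    using smooth_coefficient_bounded[OF \<Omega>(2) b0] by metis
  define d where "d = real CARD('d)"
  define m1 where "m1 = (\<Sum>i\<in>UNIV. \<bar>C1 i\<bar>)"
  define m2 where "m2 = (\<Sum>i\<in>UNIV. \<Sum>j\<in>UNIV. \<bar>C2 i j\<bar>)"
  have m: "0 \<le> m1" "0 \<le> m2" "0 \<le> d" by (auto simp: m1_def m2_def d_def intro!: sum_nonneg)
  have c1: "norm (b1 x t s) \<le> d * m1" if "x \<in> \<Omega>" "t \<in> {0..T}" "s \<in> {0..T}" for x t s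
    unfolding d_def
  proof (rule norm_vec_le_of_components)
    fix i
    have "\<bar>C1 i\<bar> \<le> m1" unfolding m1_def by (intro member_le_sum) auto
    then show "\<bar>b1 x t s $ i\<bar> \<le> m1" using C1[OF that, of i] by linarith
  qed
  have c2: "norm (b2 x t s *v \<xi>) \<le> d * m2 * norm \<xi>" if "x \<in> \<Omega>" "t \<in> {0..T}" "s \<in> {0..T}" for x t s \<xi>
    unfolding d_def mult.assoc
  proof (rule norm_vec_le_of_components)
    fix i
    have "\<bar>(b2 x t s *v \<xi>) $ i\<bar> \<le> (\<Sum>j\<in>UNIV. \<bar>b2 x t s $ i $ j * \<xi> $ j\<bar>)"
      by (simp add: matrix_vector_mult_def sum_abs)
    also have "\<dots> \<le> (\<Sum>j\<in>UNIV. \<bar>C2 i j\<bar> * norm \<xi>)"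
      unfolding abs_mult
    proof (intro sum_mono mult_mono)
      fix j
      show "\<bar>b2 x t s $ i $ j\<bar> \<le> \<bar>C2 i j\<bar>" using C2[OF that, of i j] by linarith
    qed (auto simp: component_le_norm_cart)
    also have "\<dots> = (\<Sum>j\<in>UNIV. \<bar>C2 i j\<bar>) * norm \<xi>" by (simp add: sum_distrib_right)
    also have "\<dots> \<le> m2 * norm \<xi>"
      unfolding m2_def by (intro mult_right_mono member_le_sum[of i UNIV "\<lambda>i. \<Sum>j\<in>UNIV. \<bar>C2 i j\<bar>"]) (auto intro!: sum_nonneg)
    finally show "\<bar>(b2 x t s *v \<xi>) $ i\<bar> \<le> m2 * norm \<xi>" .
  qed
  obtain R where R: "\<And>x. x \<in> \<Omega> \<Longrightarrow> norm x \<le> R" "0 \<le> R"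
    using \<Omega>(2) bounded_pos by (metis less_imp_le)
  note P = Poincare_inequality[OF \<Omega> R]
  have "\<bar>Bform \<Omega> b2 b1 b0 t s w v\<bar>
      \<le> (d * m2 + d * m1 * (2 * R) + c0 * (2 * R) * (2 * R)) * (L2_norm \<Omega> (wgrad \<Omega> w) * L2_norm \<Omega> (wgrad \<Omega> v))"
    if t: "t \<in> {0..T}" and s: "s \<in> {0..T}" and w: "w \<in> H10_space \<Omega>" and v: "v \<in> H10_space \<Omega>" for t s w v
  proof -
    note sw = square_integrable_H10[OF w] and sv = square_integrable_H10[OF v]
    note sgw = square_integrable_wgrad[OF H10_sobolev[OF w]] and sgv = square_integrable_wgrad[OF H10_sobolev[OF v]]
    let ?w = "L2_norm \<Omega> (wgrad \<Omega> w)" and ?v = "L2_norm \<Omega> (wgrad \<Omega> v)"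
    have "\<bar>L2_inner \<Omega> (\<lambda>x. b2 x t s *v wgrad \<Omega> w x) (wgrad \<Omega> v)\<bar> \<le> d * m2 * (?w * ?v)"
    proof (rule abs_L2_inner_le[OF sgw sgv])
      fix x assume x: "x \<in> \<Omega>"
      have "\<bar>(b2 x t s *v wgrad \<Omega> w x) \<bullet> wgrad \<Omega> v x\<bar> \<le> norm (b2 x t s *v wgrad \<Omega> w x) * norm (wgrad \<Omega> v x)"
        by (rule Cauchy_Schwarz_ineq2)
      also have "\<dots> \<le> d * m2 * norm (wgrad \<Omega> w x) * norm (wgrad \<Omega> v x)"
        using c2[OF x t s] by (intro mult_right_mono) auto
      finally show "\<bar>(b2 x t s *v wgrad \<Omega> w x) \<bullet> wgrad \<Omega> v x\<bar> \<le> d * m2 * (norm (wgrad \<Omega> w x) * norm (wgrad \<Omega> v x))"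
        by (simp add: mult.assoc)
    qed (use m in simp)
    moreover have "\<bar>L2_inner \<Omega> (\<lambda>x. w x *\<^sub>R b1 x t s) (wgrad \<Omega> v)\<bar> \<le> d * m1 * (L2_norm \<Omega> w * ?v)"
    proof (rule abs_L2_inner_le[OF sw sgv])
      fix x assume x: "x \<in> \<Omega>"
      have "\<bar>(w x *\<^sub>R b1 x t s) \<bullet> wgrad \<Omega> v x\<bar> \<le> norm (w x *\<^sub>R b1 x t s) * norm (wgrad \<Omega> v x)"
        by (rule Cauchy_Schwarz_ineq2)
      also have "\<dots> \<le> (norm (w x) * (d * m1)) * norm (wgrad \<Omega> v x)"
        unfolding norm_scaleR real_norm_def
        using c1[OF x t s] by (intro mult_right_mono mult_left_mono) auto
      finally show "\<bar>(w x *\<^sub>R b1 x t s) \<bullet> wgrad \<Omega> v x\<bar> \<le> d * m1 * (norm (w x) * norm (wgrad \<Omega> v x))"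
        by (simp add: mult_ac)
    qed (use m in simp)
    moreover have "d * m1 * (L2_norm \<Omega> w * ?v) \<le> d * m1 * ((2 * R * ?w) * ?v)"
      using m by (intro mult_left_mono mult_right_mono P w) (auto simp: L2_norm_nonneg)
    moreover have "\<bar>L2_inner \<Omega> (\<lambda>x. b0 x t s * w x) v\<bar> \<le> c0 * (L2_norm \<Omega> w * L2_norm \<Omega> v)"
    proof (rule abs_L2_inner_le[OF sw sv c0(1)])
      fix x assume x: "x \<in> \<Omega>"
      have "\<bar>b0 x t s\<bar> * (\<bar>w x\<bar> * \<bar>v x\<bar>) \<le> c0 * (\<bar>w x\<bar> * \<bar>v x\<bar>)"
        using c0(2)[OF x t s] by (intro mult_right_mono) auto
      then show "\<bar>(b0 x t s * w x) \<bullet> v x\<bar> \<le> c0 * (norm (w x) * norm (v x))"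
        by (simp add: abs_mult mult_ac)
    qed
    moreover have "c0 * (L2_norm \<Omega> w * L2_norm \<Omega> v) \<le> c0 * ((2 * R * ?w) * (2 * R * ?v))"
      using c0 R(2) by (intro mult_left_mono mult_mono P w v) (auto simp: L2_norm_nonneg)
    ultimately have "\<bar>Bform \<Omega> b2 b1 b0 t s w v\<bar>
        \<le> d * m2 * (?w * ?v) + d * m1 * ((2 * R * ?w) * ?v) + c0 * ((2 * R * ?w) * (2 * R * ?v))"
      unfolding Bform_def by linarith
    also have "\<dots> = (d * m2 + d * m1 * (2 * R) + c0 * (2 * R) * (2 * R)) * (?w * ?v)"
      by (simp add: algebra_simps)
    finally show ?thesis .
  qed
  moreover have "0 \<le> d * m2 + d * m1 * (2 * R) + c0 * (2 * R) * (2 * R)"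
    using m c0 R by simp
  ultimately show thesis using that by blast
qed

section \<open>The energy argument\<close>

context graded_mesh
begin

lemma \<tau>_mono: "1 \<le> l \<Longrightarrow> \<tau> l \<le> \<tau> (Suc l)"
proof -
  assume l: "1 \<le> l"
  have "1 \<le> ((real l + 1) / real l) powr (\<delta> - 1)"
    using l \<delta> by (intro ge_one_powr_ge_zero) auto
  then have "1 * \<tau> l \<le> ((real l + 1) / real l) powr (\<delta> - 1) * \<tau> l"
    using \<tau>_pos[OF l] by (intro mult_right_mono) auto
  with \<tau>_ratio[OF l] show ?thesis by simp
qed

lemma sum_\<tau>_Suc: "1 \<le> n \<Longrightarrow> (\<Sum>j=1..n-1. \<tau> (Suc j)) = t n - t 1"
proof (induction n rule: dec_induct)
  case (step n)
  then obtain m where "n = Suc m" by (cases n) auto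
  with step show ?case by (simp add: tstep_def)
qed simp

lemma \<tau>_1_le: "\<tau> 1 \<le> T / real N"
proof -
  have "real N powr 1 \<le> real N powr \<delta>"
    using N \<delta> by (intro powr_mono) auto
  then have "T / real N powr \<delta> \<le> T / real N"
    using N T by (intro divide_left_mono) auto
  then show ?thesis using \<delta> by (simp add: tstep_def tnode_def powr_divide)
qed

text \<open>Discrete form of the fact that the Caputo derivative of half the squared norm is at most
  the pairing of the derivative with the function. It rests on the weights \<open>k n j\<close>
  being nondecreasing in \<open>j\<close>.\<close>

lemma L1_caputo_energy:
  fixes u :: "nat \<Rightarrow> real^'d \<Rightarrow> real"
  assumes n: "1 \<le> n" and u: "\<And>j. j \<le> n \<Longrightarrow> square_integrable \<Omega> (u j)"
  shows "(\<Sum>j=1..n. k n j * ((L2_norm \<Omega> (u j))\<^sup>2 - (L2_norm \<Omega> (u (j - 1)))\<^sup>2)) / 2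
    \<le> L2_inner \<Omega> (L1_caputo T \<alpha> \<delta> N u n) (u n)"
proof -
  have eq: "L2_inner \<Omega> (L1_caputo T \<alpha> \<delta> N u n) (u n)
    = (\<Sum>j=1..n. k n j * (L2_inner \<Omega> (u j) (u n) - L2_inner \<Omega> (u (j - 1)) (u n)))"
  proof -
    have i: "integrable (lebesgue_on \<Omega>) (\<lambda>x. u j x * u n x)" if "j \<le> n" for j
      using square_integrable_inner[OF u[OF that] u[of n]] by simp
    have "L2_inner \<Omega> (L1_caputo T \<alpha> \<delta> N u n) (u n)
      = (LINT x|lebesgue_on \<Omega>. (\<Sum>j=1..n. k n j * (u j x * u n x - u (j - 1) x * u n x)))"
      by (simp add: L2_inner_def L1_caputo_def sum_distrib_right left_diff_distrib mult.assoc)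
    also have "\<dots> = (\<Sum>j=1..n. LINT x|lebesgue_on \<Omega>. k n j * (u j x * u n x - u (j - 1) x * u n x))"
      using i by (intro Bochner_Integration.integral_sum integrable_mult_right Bochner_Integration.integrable_diff) auto
    also have "\<dots> = (\<Sum>j=1..n. k n j * (L2_inner \<Omega> (u j) (u n) - L2_inner \<Omega> (u (j - 1)) (u n)))"
    proof (rule sum.cong[OF refl])
      fix j assume "j \<in> {1..n}"
      then have "j \<le> n" "j - 1 \<le> n" by auto
      then show "(LINT x|lebesgue_on \<Omega>. k n j * (u j x * u n x - u (j - 1) x * u n x))
        = k n j * (L2_inner \<Omega> (u j) (u n) - L2_inner \<Omega> (u (j - 1)) (u n))"
        using i by (simp add: L2_inner_def)
    qed
    finally show ?thesis .
  qed
  \<comment> \<open>The squared norm of \<open>u j - u n\<close>, expanded; it vanishes at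
    \<open>j = n\<close>.\<close>
  define e where "e j = (L2_norm \<Omega> (u j))\<^sup>2 - 2 * L2_inner \<Omega> (u j) (u n) + (L2_norm \<Omega> (u n))\<^sup>2" for j
  have e: "0 \<le> e j" if "j \<le> n" for j
  proof -
    have "L2_inner \<Omega> (u j) (u n) \<le> L2_norm \<Omega> (u j) * L2_norm \<Omega> (u n)"
      using L2_Cauchy_Schwarz[OF u[OF that] u[of n]] by simp
    moreover have "0 \<le> (L2_norm \<Omega> (u j) - L2_norm \<Omega> (u n))\<^sup>2" by simp
    ultimately show ?thesis unfolding e_def power2_diff by linarith
  qed
  have "e n = 0" by (simp add: e_def L2_norm_sq)
  then have "0 \<le> k n 1 * e 0 - k n n * e n"
    using e[of 0] L1_weight_nonneg[of 1 n] n by simp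
  also have "\<dots> \<le> (\<Sum>j=1..n. k n j * (e (j - 1) - e j))"
    using n e by (intro weighted_telescope_ge L1_weight_mono) auto
  also have "\<dots> = 2 * (\<Sum>j=1..n. k n j * (L2_inner \<Omega> (u j) (u n) - L2_inner \<Omega> (u (j - 1)) (u n)))
    - (\<Sum>j=1..n. k n j * ((L2_norm \<Omega> (u j))\<^sup>2 - (L2_norm \<Omega> (u (j - 1)))\<^sup>2))"
    unfolding sum_distrib_left sum_subtractf[symmetric]
    by (intro sum.cong) (simp_all add: e_def algebra_simps)
  finally show ?thesis unfolding eq by simp
qed

text \<open>The averages pair \<open>g (j + 1)\<close> with \<open>\<tau> (j + 1)\<close>, the
  target sum pairs it with the larger \<open>\<tau> (j + 2)\<close>. Hence both halves of the
  averages fit under the same sum, which costs the factor 2. The last index is not averaged, so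
  \<open>g n\<close> never enters.\<close>

lemma memory_sum_le:
  assumes n: "1 \<le> n" "n \<le> N" and g: "\<And>j. 0 \<le> g j" and c: "0 \<le> c" and G: "0 \<le> G"
    and b: "\<And>j. 1 \<le> j \<Longrightarrow> j < n \<Longrightarrow> b j \<le> c * G * (if j = n - 1 then g j else (g j + g (j + 1)) / 2)"
  shows "(\<Sum>j=1..n-1. \<tau> (j + 1) * b j) \<le> 2 * c * G * (\<Sum>j=1..n-1. \<tau> (Suc j) * g j)"
proof -
  have avg: "(p + q) / 2 \<le> p + r" if "0 \<le> p" "0 \<le> q" "q \<le> r" for p q r :: real
    using that by simp
  have "(\<Sum>j=1..n-1. \<tau> (j + 1) * b j)
    \<le> (\<Sum>j=1..n-1. c * G * (\<tau> (Suc j) * g j + (if j = n - 1 then 0 else \<tau> (Suc (Suc j)) * g (Suc j))))"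
  proof (rule sum_mono)
    fix j assume j: "j \<in> {1..n-1}"
    then have \<tau>: "0 \<le> \<tau> (Suc j)" "\<tau> (Suc j) \<le> \<tau> (Suc (Suc j))"
      using \<tau>_pos[of "Suc j"] \<tau>_mono[of "Suc j"] by auto
    have "\<tau> (Suc j) * b j \<le> \<tau> (Suc j) * (c * G * (if j = n - 1 then g j else (g j + g (j + 1)) / 2))"
      using j \<tau> by (intro mult_left_mono b) auto
    also have "\<dots> = c * G * (if j = n - 1 then \<tau> (Suc j) * g j else (\<tau> (Suc j) * g j + \<tau> (Suc j) * g (Suc j)) / 2)"
      by (simp add: algebra_simps)
    also have "\<dots> \<le> c * G * (\<tau> (Suc j) * g j + (if j = n - 1 then 0 else \<tau> (Suc (Suc j)) * g (Suc j)))"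
    proof (rule mult_left_mono)
      have "0 \<le> \<tau> (Suc j) * g j" "0 \<le> \<tau> (Suc j) * g (Suc j)" "\<tau> (Suc j) * g (Suc j) \<le> \<tau> (Suc (Suc j)) * g (Suc j)"
        using \<tau> g by (auto intro: mult_right_mono)
      then have "(\<tau> (Suc j) * g j + \<tau> (Suc j) * g (Suc j)) / 2 \<le> \<tau> (Suc j) * g j + \<tau> (Suc (Suc j)) * g (Suc j)"
        by (rule avg)
      then show "(if j = n - 1 then \<tau> (Suc j) * g j else (\<tau> (Suc j) * g j + \<tau> (Suc j) * g (Suc j)) / 2)
        \<le> \<tau> (Suc j) * g j + (if j = n - 1 then 0 else \<tau> (Suc (Suc j)) * g (Suc j))"
        by (simp only: add_0_right order_refl simp_thms split: if_split) blast
    qed (use c G in simp)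
    finally show "\<tau> (j + 1) * b j \<le> c * G * (\<tau> (Suc j) * g j + (if j = n - 1 then 0 else \<tau> (Suc (Suc j)) * g (Suc j)))"
      by simp
  qed
  also have "\<dots> = c * G * ((\<Sum>j=1..n-1. \<tau> (Suc j) * g j) + (\<Sum>j=1..n-1. if j = n - 1 then 0 else \<tau> (Suc (Suc j)) * g (Suc j)))"
    by (simp only: sum_distrib_left[symmetric] sum.distrib)
  also have "\<dots> \<le> c * G * ((\<Sum>j=1..n-1. \<tau> (Suc j) * g j) + (\<Sum>j=1..n-1. \<tau> (Suc j) * g j))"
  proof (intro mult_left_mono add_left_mono)
    have "(\<Sum>j=1..n-1. if j = n - 1 then 0 else \<tau> (Suc (Suc j)) * g (Suc j)) = (\<Sum>j | j \<in> {1..n-1} \<and> j \<noteq> n - 1. \<tau> (Suc (Suc j)) * g (Suc j))"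
      by (rule sum.mono_neutral_cong_right) auto
    also have "\<dots> = (\<Sum>j\<in>{2..n-1}. \<tau> (Suc j) * g j)"
      by (rule sum.reindex_bij_witness[of _ "\<lambda>j. j - 1" Suc]) auto
    also have "\<dots> \<le> (\<Sum>j=1..n-1. \<tau> (Suc j) * g j)"
      using g \<tau>_pos by (intro sum_mono2 mult_nonneg_nonneg) (auto intro: less_imp_le)
    finally show "(\<Sum>j=1..n-1. if j = n - 1 then 0 else \<tau> (Suc (Suc j)) * g (Suc j)) \<le> (\<Sum>j=1..n-1. \<tau> (Suc j) * g j)" .
  qed (use c G in simp)
  finally show ?thesis by simp
qed

text \<open>Young's inequality will leave the square of a sum of norms, whereas the stability result
  handles sums of squared norms. Cauchy-Schwarz with the weights \<open>\<tau> (Suc j)\<close>, of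
  total at most \<open>T\<close>, bridges the two.\<close>

lemma sum_\<tau>_power2_le:
  assumes n: "1 \<le> n" "n \<le> N"
  shows "(\<Sum>j=1..n-1. \<tau> (Suc j) * g j)\<^sup>2 \<le> T * (\<Sum>j=1..n-1. \<tau> (Suc j) * (g j)\<^sup>2)"
proof -
  have \<tau>: "0 \<le> \<tau> (Suc j)" for j using \<tau>_pos[of "Suc j"] by simp
  have "(\<Sum>j=1..n-1. \<tau> (Suc j) * g j)\<^sup>2 = (\<Sum>j=1..n-1. sqrt (\<tau> (Suc j)) * (sqrt (\<tau> (Suc j)) * g j))\<^sup>2"
    using \<tau> by (simp add: mult.assoc[symmetric])
  also have "\<dots> \<le> (\<Sum>j=1..n-1. (sqrt (\<tau> (Suc j)))\<^sup>2) * (\<Sum>j=1..n-1. (sqrt (\<tau> (Suc j)) * g j)\<^sup>2)"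
    by (rule Cauchy_Schwarz_ineq_sum)
  also have "\<dots> = (t n - t 1) * (\<Sum>j=1..n-1. \<tau> (Suc j) * (g j)\<^sup>2)"
    using \<tau> sum_\<tau>_Suc[OF n(1)] by (simp add: power_mult_distrib)
  also have "\<dots> \<le> T * (\<Sum>j=1..n-1. \<tau> (Suc j) * (g j)\<^sup>2)"
    using \<tau> t_le_T[OF n(2)] t_pos[of 1] by (intro mult_right_mono sum_nonneg) auto
  finally show ?thesis .
qed

end

text \<open>The barrier \<open>Y\<close> is linear in \<open>y 0\<close> and \<open>A\<close> with
  coefficients free of \<open>N\<close>; they are collected here into one constant that is fixed
  before \<open>N\<close> and the sequences.\<close>

lemma L1_energy_stability_uniform:
  assumes T: "0 < T" and \<alpha>: "0 < \<alpha>" "\<alpha> < 1" and \<delta>: "1 \<le> \<delta>" and m: "0 < m" and c: "0 \<le> c"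
  obtains C :: real where "0 < C"
    "\<And>N y g A n. \<lbrakk>1 \<le> N; 0 \<le> A; \<And>n. 0 \<le> y n; \<And>n. 0 \<le> g n;
      \<And>n. 1 \<le> n \<Longrightarrow> n \<le> N \<Longrightarrow>
        (\<Sum>j=1..n. L1_weight T \<alpha> \<delta> N n j * (y j - y (j - 1))) + m * g n
        \<le> A + c * (\<Sum>j=1..n-1. tstep T \<delta> N (Suc j) * g j);
      1 \<le> n; n \<le> N\<rbrakk> \<Longrightarrow> y n \<le> C * (y 0 + A) \<and> tstep T \<delta> N n powr \<alpha> * g n \<le> C * (y 0 + A)"
proof -
  define L where "L = c * (\<delta> * 2 powr (\<delta> - 1))"
  define X where "X = L / m * exp (L / m * T)"
  define \<theta> where "\<theta> = Gamma (2 - \<alpha>) * T powr \<alpha> / (1 - \<alpha>)"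
  define r where "r = T powr (1 - \<alpha>) / ((1 - \<alpha>) * Gamma (2 - \<alpha>))"
  define C1 where "C1 = 1 + \<theta> + X * r * \<theta> + X * T * \<theta>"
  define C where "C = C1 + C1 / (m * Gamma (2 - \<alpha>))"
  have \<Gamma>: "0 < Gamma (2 - \<alpha>)" using \<alpha> by (intro Gamma_real_pos) auto
  have p: "0 \<le> L" "0 \<le> X" "0 \<le> \<theta>" "0 \<le> r"
    unfolding X_def \<theta>_def r_def L_def using m c \<delta> \<alpha> T \<Gamma> by (auto intro!: mult_nonneg_nonneg divide_nonneg_pos)
  have C1: "1 \<le> C1" unfolding C1_def using p T by (auto intro!: add_nonneg_nonneg)
  show thesis
  proof
    show "0 < C" unfolding C_def using C1 m \<Gamma> by (intro add_pos_pos divide_pos_pos mult_pos_pos) auto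
    fix N :: nat and y g :: "nat \<Rightarrow> real" and A n
    assume N: "1 \<le> N" and A: "0 \<le> A" and y: "\<And>n. 0 \<le> y n" and g: "\<And>n. 0 \<le> g n"
      and ineq: "\<And>n. 1 \<le> n \<Longrightarrow> n \<le> N \<Longrightarrow>
        (\<Sum>j=1..n. L1_weight T \<alpha> \<delta> N n j * (y j - y (j - 1))) + m * g n
        \<le> A + c * (\<Sum>j=1..n-1. tstep T \<delta> N (Suc j) * g j)"
      and n: "1 \<le> n" "n \<le> N"
    interpret graded_mesh T \<alpha> \<delta> N using T \<alpha> \<delta> N by unfold_locales
    define A' where "A' = A + L * ((T powr (1 - \<alpha>) / ((1 - \<alpha>) * Gamma (2 - \<alpha>)) * y 0 + T * A) / m * exp (L / m * T))"
    define Y where "Y = y 0 + A' * (Gamma (2 - \<alpha>) * T powr \<alpha> / (1 - \<alpha>))"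
    note st = L1_energy_stability[OF m c A y g ineq L_def A'_def Y_def n]
    have "Y = (1 + X * r * \<theta>) * y 0 + (\<theta> + X * T * \<theta>) * A"
      unfolding Y_def A'_def \<theta>_def[symmetric] r_def[symmetric] using m by (simp add: X_def algebra_simps add_divide_distrib)
    also have "\<dots> \<le> C1 * y 0 + C1 * A"
    proof -
      have "0 \<le> X * r * \<theta>" "0 \<le> X * T * \<theta>" using p T by auto
      then have "1 + X * r * \<theta> \<le> C1" "\<theta> + X * T * \<theta> \<le> C1" using p unfolding C1_def by linarith+
      then show ?thesis by (intro add_mono mult_right_mono y A)
    qed
    finally have Y: "Y \<le> C1 * (y 0 + A)" by (simp add: algebra_simps)
    have Z: "0 \<le> y 0 + A" using y[of 0] A by simp
    have "y n \<le> C1 * (y 0 + A)" using st(1) Y by simp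
    also have "\<dots> \<le> C * (y 0 + A)"
      unfolding C_def using Z C1 m \<Gamma> by (intro mult_right_mono) auto
    finally have 1: "y n \<le> C * (y 0 + A)" .
    have "\<tau> n powr \<alpha> * g n \<le> Y / (m * Gamma (2 - \<alpha>))" by (rule st(2))
    also have "\<dots> \<le> C1 * (y 0 + A) / (m * Gamma (2 - \<alpha>))"
      using Y m \<Gamma> by (intro divide_right_mono) auto
    also have "\<dots> = C1 / (m * Gamma (2 - \<alpha>)) * (y 0 + A)" by simp
    also have "\<dots> \<le> C * (y 0 + A)"
      unfolding C_def using Z C1 by (intro mult_right_mono) auto
    finally show "y n \<le> C * (y 0 + A) \<and> \<tau> n powr \<alpha> * g n \<le> C * (y 0 + A)" using 1 by simp
  qed
qed

section \<open>The energy inequality of the scheme\<close>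

lemma young_inequality:
  fixes a b m :: real
  assumes "0 < m" shows "a * b \<le> m / 4 * a\<^sup>2 + b\<^sup>2 / m"
proof -
  have "0 \<le> (m * a / 2 - b)\<^sup>2 / m" using assms by simp
  also have "\<dots> = m / 4 * a\<^sup>2 + b\<^sup>2 / m - a * b"
    using assms by (simp add: power2_eq_square field_simps)
  finally show ?thesis by simp
qed

text \<open>\<open>M\<close> is evaluated at squared gradient norms, which may vanish; at 0 the
  bound is inherited through the limit.\<close>

lemma lower_bound_at_zero:
  fixes M :: "real \<Rightarrow> real"
  assumes "(M \<longlongrightarrow> M 0) (at_right 0)" "\<And>s. s > 0 \<Longrightarrow> M s \<ge> m0" "0 \<le> s"
  shows "m0 \<le> M s"
proof (cases "s = 0")
  case True
  have "m0 \<le> M 0"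
  proof (rule tendsto_lowerbound[OF assms(1)])
    show "\<forall>\<^sub>F s in at_right 0. m0 \<le> M s"
      by (rule eventually_at_rightI[of 0 1]) (simp_all add: assms(2))
  qed simp
  then show ?thesis using True by simp
qed (use assms in auto)

lemma discrete_energy_inequality:
  fixes \<Omega> :: "(real^'d) set"
  assumes mesh: "graded_mesh T \<alpha> \<delta> N"
    and X: "X \<subseteq> H10_space \<Omega>"
    and sol: "fully_discrete_solution \<Omega> T \<alpha> \<delta> M b2 b1 b0 u0 f N X u"
    and M: "\<And>s. 0 \<le> s \<Longrightarrow> m0 \<le> M s" and m0: "0 < m0"
    and P: "0 \<le> P" "\<And>v. v \<in> H10_space \<Omega> \<Longrightarrow> L2_norm \<Omega> v \<le> P * L2_norm \<Omega> (wgrad \<Omega> v)"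
    and c: "0 \<le> c" "\<And>t s w v. t \<in> {0..T} \<Longrightarrow> s \<in> {0..T} \<Longrightarrow> w \<in> H10_space \<Omega> \<Longrightarrow> v \<in> H10_space \<Omega> \<Longrightarrow>
      \<bar>Bform \<Omega> b2 b1 b0 t s w v\<bar> \<le> c * (L2_norm \<Omega> (wgrad \<Omega> w) * L2_norm \<Omega> (wgrad \<Omega> v))"
    and small: "c * tstep T \<delta> N 1 \<le> m0 / 4"
    and f: "\<And>n. 1 \<le> n \<Longrightarrow> n \<le> N \<Longrightarrow> square_integrable \<Omega> (f (tnode T \<delta> N n))"
    and F: "\<And>n. 1 \<le> n \<Longrightarrow> n \<le> N \<Longrightarrow> L2_norm \<Omega> (f (tnode T \<delta> N n)) \<le> F"
    and n: "1 \<le> n" "n \<le> N"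
  shows "(\<Sum>j=1..n. L1_weight T \<alpha> \<delta> N n j * ((L2_norm \<Omega> (u j))\<^sup>2 - (L2_norm \<Omega> (u (j - 1)))\<^sup>2))
      + m0 * (L2_norm \<Omega> (wgrad \<Omega> (u n)))\<^sup>2
    \<le> 2 * (P * F)\<^sup>2 / m0
      + 8 * c\<^sup>2 * T / m0 * (\<Sum>j=1..n-1. tstep T \<delta> N (Suc j) * (L2_norm \<Omega> (wgrad \<Omega> (u j)))\<^sup>2)"
proof -
  interpret graded_mesh T \<alpha> \<delta> N by (rule mesh)
  define g where "g j = L2_norm \<Omega> (wgrad \<Omega> (u j))" for j
  define D where "D = L2_inner \<Omega> (L1_caputo T \<alpha> \<delta> N u n) (u n)"
  define S where "S = (\<Sum>j=1..n-1. \<tau> (Suc j) * (g j)\<^sup>2)"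
  note sol = sol[unfolded fully_discrete_solution_def Let_def is_ritz_projection_def is_L2_projection_def]
  have uX: "u j \<in> X" if "j \<le> N" for j
    using sol that by (cases "j = 0") auto
  then have u: "u j \<in> H10_space \<Omega>" if "j \<le> N" for j using X that by blast
  have g0: "0 \<le> g j" for j by (simp add: g_def L2_norm_nonneg)
  obtain fh where fh: "\<And>n v. n \<in> {1..N} \<Longrightarrow> v \<in> X \<Longrightarrow> L2_inner \<Omega> (fh n) v = L2_inner \<Omega> (f (t n)) v"
    and eq1: "\<And>v. v \<in> X \<Longrightarrow> L2_inner \<Omega> (L1_caputo T \<alpha> \<delta> N u 1) v
           + M ((L2_norm \<Omega> (wgrad \<Omega> (u 1)))\<^sup>2) * L2_inner \<Omega> (wgrad \<Omega> (u 1)) (wgrad \<Omega> v)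
           = L2_inner \<Omega> (fh 1) v + \<tau> 1 * Bform \<Omega> b2 b1 b0 (t 1) (t 1) (u 1) v"
    and eq2: "\<And>n v. n \<in> {2..N} \<Longrightarrow> v \<in> X \<Longrightarrow> L2_inner \<Omega> (L1_caputo T \<alpha> \<delta> N u n) v
           + M ((L2_norm \<Omega> (wgrad \<Omega> (extrapolation T \<delta> N u n)))\<^sup>2)
             * L2_inner \<Omega> (wgrad \<Omega> (u n)) (wgrad \<Omega> v)
           = L2_inner \<Omega> (fh n) v + (\<Sum>j=1..n-1. \<tau> (j + 1) * Bbar (Bform \<Omega> b2 b1 b0) t u n j v)"
    using sol by blast
  have tT: "t j \<in> {0..T}" if "j \<le> N" for j
    using t_le_T[OF that] t_le[of 0 j] t_0 by simp
  have B: "\<bar>Bform \<Omega> b2 b1 b0 (t i) (t j) (u j) (u n)\<bar> \<le> c * g n * g j" if "i \<le> N" "j \<le> N" for i j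
    using c(2)[OF tT[OF that(1)] tT[OF that(2)] u[OF that(2)] u[OF n(2)]] by (simp add: g_def mult_ac)
  have S0: "0 \<le> S"
    unfolding S_def using \<tau>_pos by (intro sum_nonneg mult_nonneg_nonneg) (auto intro: less_imp_le)
  have mem: "(if n = 1 then \<tau> 1 * Bform \<Omega> b2 b1 b0 (t 1) (t 1) (u 1) (u n)
      else (\<Sum>j=1..n-1. \<tau> (j + 1) * Bbar (Bform \<Omega> b2 b1 b0) t u n j (u n)))
      \<le> m0 / 4 * (g n)\<^sup>2 + 4 * c\<^sup>2 * T / m0 * S" (is "?m \<le> _")
  proof (cases "n = 1")
    case True
    \<comment> \<open>Here the memory term contains the unknown level itself. It is quadratic in
      \<open>g 1\<close>, and \<open>small\<close> fits it into the same share \<open>m0 / 4\<close>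
      that Young's inequality spends at later levels.\<close>
    have "\<tau> 1 * Bform \<Omega> b2 b1 b0 (t 1) (t 1) (u 1) (u n) \<le> \<tau> 1 * (c * g n * g 1)"
      using B[of 1 1] \<tau>_pos[of 1] N by (intro mult_left_mono) auto
    also have "\<dots> = (c * \<tau> 1) * (g n)\<^sup>2" using True by (simp add: power2_eq_square)
    also have "\<dots> \<le> m0 / 4 * (g n)\<^sup>2" by (intro mult_right_mono small) simp
    finally have "?m \<le> m0 / 4 * (g n)\<^sup>2" using True by simp
    moreover have "0 \<le> 4 * c\<^sup>2 * T / m0 * S" using T m0 S0 by simp
    ultimately show ?thesis by linarith
  next
    case False
    have b: "Bbar (Bform \<Omega> b2 b1 b0) t u n j (u n) \<le> c * g n * (if j = n - 1 then g j else (g j + g (j + 1)) / 2)"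
      if "1 \<le> j" "j < n" for j
    proof (cases "j = n - 1")
      case True
      then show ?thesis using B[of n j] that n by (simp add: Bbar_def)
    next
      case False
      have "j \<le> N" "j + 1 \<le> N" using that n by auto
      then have "Bform \<Omega> b2 b1 b0 (t n) (t j) (u j) (u n) + Bform \<Omega> b2 b1 b0 (t n) (t (j + 1)) (u (j + 1)) (u n)
        \<le> c * g n * g j + c * g n * g (j + 1)"
        using B[of n j] B[of n "j + 1"] n by (intro add_mono) auto
      then show ?thesis using False by (simp add: Bbar_def distrib_left)
    qed
    have "?m \<le> 2 * c * g n * (\<Sum>j=1..n-1. \<tau> (Suc j) * g j)"
      using False b memory_sum_le[OF n g0 c(1) g0[of n]] by simp
    also have "\<dots> = g n * (2 * c * (\<Sum>j=1..n-1. \<tau> (Suc j) * g j))" by simp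
    also have "\<dots> \<le> m0 / 4 * (g n)\<^sup>2 + (2 * c * (\<Sum>j=1..n-1. \<tau> (Suc j) * g j))\<^sup>2 / m0"
      by (rule young_inequality[OF m0])
    also have "\<dots> = m0 / 4 * (g n)\<^sup>2 + 4 * c\<^sup>2 / m0 * (\<Sum>j=1..n-1. \<tau> (Suc j) * g j)\<^sup>2"
      by (simp add: power_mult_distrib)
    also have "\<dots> \<le> m0 / 4 * (g n)\<^sup>2 + 4 * c\<^sup>2 / m0 * (T * S)"
      unfolding S_def using m0 by (intro add_left_mono mult_left_mono sum_\<tau>_power2_le n) auto
    finally show ?thesis by simp
  qed
  \<comment> \<open>The argument of \<open>M\<close> at level \<open>n\<close>, implicit at the
    first level and extrapolated afterwards. It is a square in both cases, so
    \<open>m0 \<le> M s\<close>.\<close>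
  define s where "s = (if n = 1 then (L2_norm \<Omega> (wgrad \<Omega> (u 1)))\<^sup>2
    else (L2_norm \<Omega> (wgrad \<Omega> (extrapolation T \<delta> N u n)))\<^sup>2)"
  have "D + M s * (g n)\<^sup>2 = L2_inner \<Omega> (fh n) (u n) + ?m"
  proof (cases "n = 1")
    case True
    then show ?thesis using eq1[OF uX[OF n(2)]] by (simp add: D_def s_def g_def L2_norm_sq)
  next
    case False
    then have "n \<in> {2..N}" using n by simp
    then show ?thesis using eq2[OF _ uX[OF n(2)]] False by (simp add: D_def s_def g_def L2_norm_sq)
  qed
  moreover have "m0 * (g n)\<^sup>2 \<le> M s * (g n)\<^sup>2"
    by (intro mult_right_mono M) (auto simp: s_def)
  moreover have "L2_inner \<Omega> (fh n) (u n) \<le> m0 / 4 * (g n)\<^sup>2 + (P * F)\<^sup>2 / m0"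
  proof -
    have "L2_inner \<Omega> (fh n) (u n) = L2_inner \<Omega> (f (t n)) (u n)"
      using fh uX n by simp
    also have "\<dots> \<le> L2_norm \<Omega> (f (t n)) * L2_norm \<Omega> (u n)"
      using L2_Cauchy_Schwarz[OF f[OF n] square_integrable_H10[OF u[OF n(2)]]] by simp
    also have "\<dots> \<le> F * (P * g n)"
      unfolding g_def using F[OF n] order_trans[OF L2_norm_nonneg F[OF n]]
      by (intro mult_mono P u n) (auto simp: L2_norm_nonneg)
    also have "\<dots> = g n * (P * F)" by simp
    also have "\<dots> \<le> m0 / 4 * (g n)\<^sup>2 + (P * F)\<^sup>2 / m0" by (rule young_inequality[OF m0])
    finally show ?thesis .
  qed
  moreover have "(\<Sum>j=1..n. k n j * ((L2_norm \<Omega> (u j))\<^sup>2 - (L2_norm \<Omega> (u (j - 1)))\<^sup>2)) / 2 \<le> D"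
    unfolding D_def using n u by (intro L1_caputo_energy square_integrable_H10) auto
  ultimately have "(\<Sum>j=1..n. k n j * ((L2_norm \<Omega> (u j))\<^sup>2 - (L2_norm \<Omega> (u (j - 1)))\<^sup>2)) / 2 + m0 * (g n)\<^sup>2
      \<le> m0 / 4 * (g n)\<^sup>2 + (P * F)\<^sup>2 / m0 + (m0 / 4 * (g n)\<^sup>2 + 4 * c\<^sup>2 * T / m0 * S)"
    using mem by linarith
  \<comment> \<open>Forcing and memory have taken \<open>m0 / 4\<close> each. Doubling what is left
    restores \<open>m0\<close> and removes the 1/2 from \<open>L1_caputo_energy\<close>.\<close>
  then have "(\<Sum>j=1..n. k n j * ((L2_norm \<Omega> (u j))\<^sup>2 - (L2_norm \<Omega> (u (j - 1)))\<^sup>2)) + m0 * (g n)\<^sup>2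
      \<le> 2 * ((P * F)\<^sup>2 / m0) + 2 * (4 * c\<^sup>2 * T / m0 * S)"
    by linarith
  then show ?thesis by (simp add: g_def S_def)
qed

section \<open>The initial value and the final constants\<close>

lemma ritz_projection_stable:
  assumes "X \<subseteq> H10_space \<Omega>" "is_ritz_projection \<Omega> X w p" "w \<in> H10_space \<Omega>"
  shows "L2_norm \<Omega> (wgrad \<Omega> p) \<le> L2_norm \<Omega> (wgrad \<Omega> w)"
proof -
  have p: "p \<in> X" and eq: "L2_inner \<Omega> (wgrad \<Omega> p) (wgrad \<Omega> p) = L2_inner \<Omega> (wgrad \<Omega> w) (wgrad \<Omega> p)"
    using assms(2) by (auto simp: is_ritz_projection_def)
  have "(L2_norm \<Omega> (wgrad \<Omega> p))\<^sup>2 \<le> L2_norm \<Omega> (wgrad \<Omega> w) * L2_norm \<Omega> (wgrad \<Omega> p)"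
    using L2_Cauchy_Schwarz[OF square_integrable_wgrad square_integrable_wgrad, OF H10_sobolev H10_sobolev, OF assms(3), of p] p assms(1) eq
    by (auto simp: L2_norm_sq)
  then show ?thesis
    using L2_norm_nonneg[of \<Omega> "wgrad \<Omega> p"] L2_norm_nonneg[of \<Omega> "wgrad \<Omega> w"]
    by (cases "L2_norm \<Omega> (wgrad \<Omega> p) = 0") (auto simp: power2_eq_square)
qed

theorem theorem4p5:
  fixes \<Omega> :: "(real^'d) set"
    and T \<alpha> \<delta> L_M m0 \<sigma> \<kappa> K :: real
    and M :: "real \<Rightarrow> real"
    and b2 :: "real^'d \<Rightarrow> real \<Rightarrow> real \<Rightarrow> real^'d^'d"
    and b1 :: "real^'d \<Rightarrow> real \<Rightarrow> real \<Rightarrow> real^'d"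
    and b0 :: "real^'d \<Rightarrow> real \<Rightarrow> real \<Rightarrow> real"
    and u0 :: "real^'d \<Rightarrow> real"
    and f :: "real \<Rightarrow> real^'d \<Rightarrow> real"
  assumes domain: "open \<Omega>" "\<Omega> \<noteq> {}" "bounded \<Omega>" "convex \<Omega>" "smooth_boundary \<Omega>"
    and params: "T > 0" "0 < \<alpha>" "\<alpha> < 1" "\<delta> \<ge> 1"
    and M_lipschitz: "L_M-lipschitz_on {0<..} M"
    and M_at_0: "(M \<longlongrightarrow> M 0) (at_right 0)"
    and b2_smooth: "\<And>i j. smooth_coefficient \<Omega> T (\<lambda>x t s. b2 x t s $ i $ j)"
    and b1_smooth: "\<And>i. smooth_coefficient \<Omega> T (\<lambda>x t s. b1 x t s $ i)"
    and b0_smooth: "smooth_coefficient \<Omega> T b0"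
    and b2_sym: "\<And>x t s. x \<in> closure \<Omega> \<Longrightarrow> t \<in> {0..T} \<Longrightarrow> s \<in> {0..T} \<Longrightarrow>
                   transpose (b2 x t s) = b2 x t s"
    and b2_pos: "\<And>x t s \<xi>. x \<in> closure \<Omega> \<Longrightarrow> t \<in> {0..T} \<Longrightarrow> s \<in> {0..T} \<Longrightarrow> \<xi> \<noteq> 0 \<Longrightarrow>
                   \<xi> \<bullet> (b2 x t s *v \<xi>) > 0"
    and u0: "u0 \<in> sobolev 2 \<Omega> \<inter> H10_space \<Omega>"
    and f: "f \<in> Linf_L2_space \<Omega> T"
    and m0: "m0 > 0" "\<And>s. s > 0 \<Longrightarrow> M s \<ge> m0"
    and K: "K = H1_norm \<Omega> u0 + real_of_ereal (Linf_L2_norm \<Omega> T f)"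
    and smallness: "m0 - 4 * L_M * K\<^sup>2 > 0"
  shows "\<exists>C>0. \<exists>N0\<ge>1. \<forall>N\<ge>N0. \<forall>\<T> u.
           triangulation_of \<Omega> \<T> \<and> shape_regular \<sigma> \<T> \<and> quasi_uniform \<kappa> \<T> \<and>
           fully_discrete_solution \<Omega> T \<alpha> \<delta> M b2 b1 b0 u0 f N (P1_space \<Omega> \<T>) u \<longrightarrow>
           (MAX n\<in>{1..N}. step_norm \<Omega> T \<alpha> \<delta> N n (u n))
           \<le> C * (L2_norm \<Omega> (wgrad \<Omega> u0) + (MAX n\<in>{1..N}. L2_norm \<Omega> (f (tnode T \<delta> N n))))"
proof -
  obtain R where R: "\<And>x. x \<in> \<Omega> \<Longrightarrow> norm x \<le> R" "0 \<le> R"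
    using domain(3) bounded_pos by (metis less_imp_le)
  define P where "P = 2 * R"
  have P: "0 \<le> P" "\<And>v. v \<in> H10_space \<Omega> \<Longrightarrow> L2_norm \<Omega> v \<le> P * L2_norm \<Omega> (wgrad \<Omega> v)"
    unfolding P_def using R(2) Poincare_inequality[OF domain(1,3) R] by auto
  obtain c where c: "0 \<le> c" "\<And>t s w v. t \<in> {0..T} \<Longrightarrow> s \<in> {0..T} \<Longrightarrow> w \<in> H10_space \<Omega> \<Longrightarrow> v \<in> H10_space \<Omega> \<Longrightarrow>
      \<bar>Bform \<Omega> b2 b1 b0 t s w v\<bar> \<le> c * (L2_norm \<Omega> (wgrad \<Omega> w) * L2_norm \<Omega> (wgrad \<Omega> v))"
    by (fact Bform_bounded[OF domain(1,3) b2_smooth b1_smooth b0_smooth])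
  have c': "0 \<le> 8 * c\<^sup>2 * T / m0" using params m0 by simp
  obtain C where C: "0 < C"
    "\<And>N y g A n. \<lbrakk>1 \<le> N; 0 \<le> A; \<And>n. 0 \<le> y n; \<And>n. 0 \<le> g n;
      \<And>n. 1 \<le> n \<Longrightarrow> n \<le> N \<Longrightarrow>
        (\<Sum>j=1..n. L1_weight T \<alpha> \<delta> N n j * (y j - y (j - 1))) + m0 * g n
        \<le> A + 8 * c\<^sup>2 * T / m0 * (\<Sum>j=1..n-1. tstep T \<delta> N (Suc j) * g j);
      1 \<le> n; n \<le> N\<rbrakk> \<Longrightarrow> y n \<le> C * (y 0 + A) \<and> tstep T \<delta> N n powr \<alpha> * g n \<le> C * (y 0 + A)"
    by (fact L1_energy_stability_uniform[OF params(1-4) m0(1) c'])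
  \<comment> \<open>Since \<open>tstep T \<delta> N 1 \<le> T / N\<close>, this makes
    \<open>c\<close> times the first step at most \<open>m0 / 4\<close>.\<close>
  define N0 where "N0 = Suc (nat \<lceil>4 * c * T / m0\<rceil>)"
  \<comment> \<open>\<open>P\<^sup>2\<close> belongs to the initial value, by the Poincare
    inequality and Ritz stability; \<open>2 * P\<^sup>2 / m0\<close> belongs to the forcing term of
    \<open>discrete_energy_inequality\<close>.\<close>
  define C' where "C' = C * (P\<^sup>2 + 2 * P\<^sup>2 / m0)"
  have C': "0 \<le> C'" unfolding C'_def using C(1) m0 by simp
  have M: "m0 \<le> M s" if "0 \<le> s" for s
    using lower_bound_at_zero[OF M_at_0 m0(2) that] .
  have main: "step_norm \<Omega> T \<alpha> \<delta> N n (u n) \<le> (2 * sqrt C' + 1) * (L2_norm \<Omega> (wgrad \<Omega> u0)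
      + (MAX n\<in>{1..N}. L2_norm \<Omega> (f (tnode T \<delta> N n))))"
    if large: "N0 \<le> N" and sol: "fully_discrete_solution \<Omega> T \<alpha> \<delta> M b2 b1 b0 u0 f N (P1_space \<Omega> \<T>) u"
      and n: "1 \<le> n" "n \<le> N" for N \<T> u n
  proof -
    have N1: "1 \<le> N" using n by simp
    interpret graded_mesh T \<alpha> \<delta> N using params N1 by unfold_locales
    define F where "F = (MAX n\<in>{1..N}. L2_norm \<Omega> (f (t n)))"
    define G where "G = L2_norm \<Omega> (wgrad \<Omega> u0)"
    have F: "L2_norm \<Omega> (f (t n)) \<le> F" if "1 \<le> n" "n \<le> N" for n
      unfolding F_def using that by (intro Max_ge) auto
    have F0: "0 \<le> F" using F[OF n] L2_norm_nonneg[of \<Omega> "f (t n)"] by linarith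
    have G0: "0 \<le> G" by (simp add: G_def L2_norm_nonneg)
    have X: "P1_space \<Omega> \<T> \<subseteq> H10_space \<Omega>" by (auto simp: P1_space_def)
    have small: "c * \<tau> 1 \<le> m0 / 4"
    proof -
      have "4 * c * T / m0 \<le> real N"
        using large unfolding N0_def by linarith
      then have "c * (T / real N) \<le> m0 / 4"
        using m0(1) N1 by (simp add: field_simps)
      moreover have "c * \<tau> 1 \<le> c * (T / real N)" by (intro mult_left_mono \<tau>_1_le c)
      ultimately show ?thesis by linarith
    qed
    have f': "square_integrable \<Omega> (f (t n))" if "1 \<le> n" "n \<le> N" for n
      using f t_pos[OF that(1)] t_le_T[OF that(2)] by (auto simp: Linf_L2_space_def L2_space_iff)
    have ritz: "is_ritz_projection \<Omega> (P1_space \<Omega> \<T>) u0 (u 0)"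
      using sol by (auto simp: fully_discrete_solution_def Let_def)
    have y0: "(L2_norm \<Omega> (u 0))\<^sup>2 \<le> (P * G)\<^sup>2"
    proof (rule power_mono)
      have "u 0 \<in> H10_space \<Omega>" using ritz X by (auto simp: is_ritz_projection_def)
      then have "L2_norm \<Omega> (u 0) \<le> P * L2_norm \<Omega> (wgrad \<Omega> (u 0))" by (rule P)
      also have "\<dots> \<le> P * G"
        unfolding G_def using u0 by (intro mult_left_mono ritz_projection_stable[OF X ritz] P) auto
      finally show "L2_norm \<Omega> (u 0) \<le> P * G" .
    qed (rule L2_norm_nonneg)
    have "(L2_norm \<Omega> (u n))\<^sup>2 \<le> C * ((L2_norm \<Omega> (u 0))\<^sup>2 + 2 * (P * F)\<^sup>2 / m0)
      \<and> \<tau> n powr \<alpha> * (L2_norm \<Omega> (wgrad \<Omega> (u n)))\<^sup>2 \<le> C * ((L2_norm \<Omega> (u 0))\<^sup>2 + 2 * (P * F)\<^sup>2 / m0)"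
    proof (rule C(2)[of N "2 * (P * F)\<^sup>2 / m0" "\<lambda>j. (L2_norm \<Omega> (u j))\<^sup>2"
          "\<lambda>j. (L2_norm \<Omega> (wgrad \<Omega> (u j)))\<^sup>2" n])
      fix n assume n: "1 \<le> n" "n \<le> N"
      show "(\<Sum>j=1..n. k n j * ((L2_norm \<Omega> (u j))\<^sup>2 - (L2_norm \<Omega> (u (j - 1)))\<^sup>2))
          + m0 * (L2_norm \<Omega> (wgrad \<Omega> (u n)))\<^sup>2
        \<le> 2 * (P * F)\<^sup>2 / m0
          + 8 * c\<^sup>2 * T / m0 * (\<Sum>j=1..n-1. \<tau> (Suc j) * (L2_norm \<Omega> (wgrad \<Omega> (u j)))\<^sup>2)"
        by (rule discrete_energy_inequality[OF graded_mesh_axioms X sol M m0(1) P c small f' F n])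
    qed (use N1 n m0 in auto)
    moreover have "C * ((L2_norm \<Omega> (u 0))\<^sup>2 + 2 * (P * F)\<^sup>2 / m0) \<le> C' * (G + F)\<^sup>2"
    proof -
      have "(L2_norm \<Omega> (u 0))\<^sup>2 + 2 * (P * F)\<^sup>2 / m0 \<le> P\<^sup>2 * (G + F)\<^sup>2 + 2 * P\<^sup>2 / m0 * (G + F)\<^sup>2"
      proof (rule add_mono)
        have "P\<^sup>2 * G\<^sup>2 \<le> P\<^sup>2 * (G + F)\<^sup>2"
          using F0 G0 by (intro mult_left_mono power_mono) auto
        then show "(L2_norm \<Omega> (u 0))\<^sup>2 \<le> P\<^sup>2 * (G + F)\<^sup>2"
          using y0 by (simp add: power_mult_distrib)
        have "2 * P\<^sup>2 / m0 * F\<^sup>2 \<le> 2 * P\<^sup>2 / m0 * (G + F)\<^sup>2"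
          using F0 G0 m0 by (intro mult_left_mono power_mono) auto
        then show "2 * (P * F)\<^sup>2 / m0 \<le> 2 * P\<^sup>2 / m0 * (G + F)\<^sup>2"
          by (simp add: power_mult_distrib)
      qed
      from mult_left_mono[OF this less_imp_le[OF C(1)]] show ?thesis
        by (simp add: C'_def algebra_simps)
    qed
    ultimately have b: "(L2_norm \<Omega> (u n))\<^sup>2 \<le> C' * (G + F)\<^sup>2"
      "\<tau> n powr \<alpha> * (L2_norm \<Omega> (wgrad \<Omega> (u n)))\<^sup>2 \<le> C' * (G + F)\<^sup>2"
      by auto
    have r: "sqrt (C' * (G + F)\<^sup>2) = sqrt C' * (G + F)"
      using F0 G0 by (simp add: real_sqrt_mult)
    have "L2_norm \<Omega> (u n) \<le> sqrt C' * (G + F)"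
      using real_sqrt_le_mono[OF b(1)] unfolding r by (simp add: L2_norm_nonneg)
    moreover have "\<tau> n powr (\<alpha> / 2) * L2_norm \<Omega> (wgrad \<Omega> (u n)) \<le> sqrt C' * (G + F)"
    proof -
      have "\<tau> n powr \<alpha> = (\<tau> n powr (\<alpha> / 2))\<^sup>2"
        by (simp add: power2_eq_square powr_add[symmetric])
      then have "sqrt (\<tau> n powr \<alpha> * (L2_norm \<Omega> (wgrad \<Omega> (u n)))\<^sup>2) = \<tau> n powr (\<alpha> / 2) * L2_norm \<Omega> (wgrad \<Omega> (u n))"
        by (simp add: real_sqrt_mult L2_norm_nonneg)
      then show ?thesis using real_sqrt_le_mono[OF b(2)] unfolding r by simp
    qed
    ultimately have "step_norm \<Omega> T \<alpha> \<delta> N n (u n) \<le> 2 * sqrt C' * (G + F)"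
      by (simp add: step_norm_def)
    \<comment> \<open>The added 1 keeps the final constant positive, as only
      \<open>0 \<le> C'\<close> is at hand.\<close>
    also have "\<dots> \<le> (2 * sqrt C' + 1) * (G + F)"
      using F0 G0 by (intro mult_right_mono) auto
    finally show ?thesis by (simp add: F_def G_def)
  qed
  show ?thesis
  proof (intro exI[of _ "2 * sqrt C' + 1"] exI[of _ N0] conjI allI impI)
    show "0 < 2 * sqrt C' + 1" using C' by (simp add: add_nonneg_pos)
    show "1 \<le> N0" by (simp add: N0_def)
    fix N \<T> u
    assume N: "N0 \<le> N" and sol: "triangulation_of \<Omega> \<T> \<and> shape_regular \<sigma> \<T> \<and> quasi_uniform \<kappa> \<T> \<and>
      fully_discrete_solution \<Omega> T \<alpha> \<delta> M b2 b1 b0 u0 f N (P1_space \<Omega> \<T>) u"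
    have "{1..N} \<noteq> {}" using N by (simp add: N0_def)
    then show "(MAX n\<in>{1..N}. step_norm \<Omega> T \<alpha> \<delta> N n (u n))
      \<le> (2 * sqrt C' + 1) * (L2_norm \<Omega> (wgrad \<Omega> u0) + (MAX n\<in>{1..N}. L2_norm \<Omega> (f (tnode T \<delta> N n))))"
      using main[OF N] sol by (intro Max.boundedI) auto
  qed
qed

end
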